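(* Let $X$ be a proper geodesic Gromov hyperbolic space with a pole. Then the following are equivalent: (1) $X$ is boundary rigid; (2) $\partial X$ is uniformly perfect; (3) $X$ is geodesically rich.
   Context: Quasi-isometries: a map $f:(X,d)\to(Y,d')$ is a $(K,C)$-quasi-isometric embedding ($K\ge 1$, $C\ge 0$) if $K^{-1}d(x,y)-C\le d'(f(x),f(y))\le Kd(x,y)+C$ for all $x,y\in X$; it is a $(K,C)$-quasi-isometry if in addition every point of $Y$ is within distance $C$ of $f(X)$; a quasi-isometry is a $(K,C)$-quasi-isometry for some $K,C$. Hyperbolicity: a geodesic metric space $X$ is $\delta$-hyperbolic if each side of every geodesic triangle lies in the closed $\delta$-neighborhood of the other two sides; Gromov hyperbolic means $\delta$-hyperbolic for some $\delta\ge0$. For a base point $w\in X$, $(x|y)_w=\frac12(d(x,w)+d(y,w)-d(x,y))$. A sequence $\{x_i\}$ is a Gromov sequence if $(x_i|x_j)_w\to\infty$ as $i,j\to\infty$; two Gromov sequences are equivalent if $(x_i|y_i)_w\to\infty$. $\partial X$ is the set of equivalence classes, $\bar X=X\cup\partial X$. A quasi-isometry $f:X\to X$ induces $\partial f:\partial X\to\partial X$, $[\{x_i\}]\mapsto[\{f(x_i)\}]$. Boundary rigid: every quasi-isometry $f:X\to X$ with $\partial f=\mathrm{id}_{\partial X}$ satisfies $\sup_{x\in X}d(x,f(x))<\infty$. Pole: $X$ has a pole if there are $L\ge0$ and $o\in\bar X$ such that each point of $X$ lies in the $L$-neighborhood of some geodesic connecting $o$ to some $v\in\partial X$. Visual metric: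 $(\xi|\zeta)_w=\inf\{\liminf_i (x_i|y_i)_w : \{x_i\}\in\xi,\{y_i\}\in\zeta\}$ for $\xi,\zeta\in\partial X$. If $X$ is $\delta$-hyperbolic with $\delta>0$ (enlarged if necessary so that geodesic triangles are also $\delta$-thin) and $0<\varepsilon<\min\{1,\frac1{5\delta}\}$, then $d_{w,\varepsilon}(\xi,\zeta)=\inf\sum_{i=1}^n e^{-\varepsilon(\xi_{i-1}|\xi_i)_w}$ over finite chains $\xi=\xi_0,\dots,\xi_n=\zeta$ in $\partial X$. Uniformly perfect: $(Z,d)$ is uniformly perfect if there are $S\ge1$, $r_0>0$ such that for each $x\in Z$ and $0<r\le r_0$ there is $y\in Z$ with $r/S<d(x,y)\le r$. "$\partial X$ is uniformly perfect" refers to a visual metric and does not depend on its choice. Geodesically rich: a geodesic metric space $(X,d)$ is geodesically rich if there are constants $r_0,r_1,r_2,r_3,r_4$ such that (i) for every pair of points $p,q\in X$ with $d(p,q)\ge r_0$ there is a bi-infinite geodesic $\gamma$ with $d(p,\gamma)<r_1$ and $|d(q,\gamma)-d(p,q)|<r_2$; and (ii) for any bi-infinite geodesic $\gamma$ and any $p\in X$ there is a bi-infinite geodesic $\gamma'$ with $d(p,\gamma')<r_3$ and $|d(p,\gamma)-d(\gamma',\gamma)|<r_4$. A bi-infinite geodesic is (the image of) an isometric embedding $\mathbb R\to X$, and distances to or between sets are infima. *)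

theory Defs
  imports "HOL-Analysis.Analysis"
begin

section \<open>Quasi-isometries\<close>

definition quasi_isometric_embedding ::
    "real \<Rightarrow> real \<Rightarrow> ('a::metric_space \<Rightarrow> 'b::metric_space) \<Rightarrow> bool" where
  "quasi_isometric_embedding K C f \<longleftrightarrow> K \<ge> 1 \<and> C \<ge> 0 \<and>
     (\<forall>x y. inverse K * dist x y - C \<le> dist (f x) (f y) \<and> dist (f x) (f y) \<le> K * dist x y + C)"

definition quasi_isometry :: "('a::metric_space \<Rightarrow> 'b::metric_space) \<Rightarrow> bool" where
  "quasi_isometry f \<longleftrightarrow>
     (\<exists>K C. quasi_isometric_embedding K C f \<and> (\<forall>y. \<exists>x. dist y (f x) \<le> C))"

section \<open>Geodesics and hyperbolicity\<close>

definition isometric_on :: "'a::metric_space set \<Rightarrow> ('a \<Rightarrow> 'b::metric_space) \<Rightarrow> bool" where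
  "isometric_on S g \<longleftrightarrow> (\<forall>s\<in>S. \<forall>t\<in>S. dist (g s) (g t) = dist s t)"

definition geodesic_path :: "(real \<Rightarrow> 'a::metric_space) \<Rightarrow> 'a \<Rightarrow> 'a \<Rightarrow> bool" where
  "geodesic_path g x y \<longleftrightarrow> g 0 = x \<and> g (dist x y) = y \<and> isometric_on {0..dist x y} g"

definition geodesic_segment :: "'a::metric_space set \<Rightarrow> 'a \<Rightarrow> 'a \<Rightarrow> bool" where
  "geodesic_segment A x y \<longleftrightarrow> (\<exists>g. geodesic_path g x y \<and> A = g ` {0..dist x y})"

definition geodesic_space :: "'a::metric_space itself \<Rightarrow> bool" where
  "geodesic_space _ \<longleftrightarrow> (\<forall>x y::'a. \<exists>A. geodesic_segment A x y)"

definition proper_space :: "'a::metric_space itself \<Rightarrow> bool" where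
  "proper_space _ \<longleftrightarrow> (\<forall>(x::'a) r. compact (cball x r))"

text \<open>The condition is imposed on one side only; cyclically permuting the vertices
  gives it for the other two.\<close>

definition delta_hyperbolic :: "'a::metric_space itself \<Rightarrow> real \<Rightarrow> bool" where
  "delta_hyperbolic _ \<delta> \<longleftrightarrow>
     (\<forall>(x::'a) y z A B C. geodesic_segment A y z \<and> geodesic_segment B z x \<and> geodesic_segment C x y
        \<longrightarrow> (\<forall>p\<in>A. infdist p (B \<union> C) \<le> \<delta>))"

definition gromov_hyperbolic :: "'a::metric_space itself \<Rightarrow> bool" where
  "gromov_hyperbolic X \<longleftrightarrow> (\<exists>\<delta>\<ge>0. delta_hyperbolic X \<delta>)"

definition gromov_product :: "'a::metric_space \<Rightarrow> 'a \<Rightarrow> 'a \<Rightarrow> real" where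
  "gromov_product w x y = (dist x w + dist y w - dist x y) / 2"

text \<open>Triangles are \<open>\<delta>\<close>-thin if the fibres of the comparison map to the tripod have diameter at
  most \<open>\<delta>\<close>.  Two points on the sides issuing from \<open>x\<close> lie in the same fibre iff they have the same
  distance \<open>t \<le> (y|z)\<^sub>x\<close> from \<open>x\<close>.\<close>

definition delta_thin :: "'a::metric_space itself \<Rightarrow> real \<Rightarrow> bool" where
  "delta_thin _ \<delta> \<longleftrightarrow>
     (\<forall>(x::'a) y z g h. geodesic_path g x y \<and> geodesic_path h x z
        \<longrightarrow> (\<forall>t\<in>{0..gromov_product x y z}. dist (g t) (h t) \<le> \<delta>))"

section \<open>Gromov boundary\<close>

text \<open>Changing the base point \<open>w\<close> changes Gromov products by at most a constant, so requiring
  divergence for all base points is the same as requiring it for one.\<close>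

definition gromov_sequence :: "(nat \<Rightarrow> 'a::metric_space) \<Rightarrow> bool" where
  "gromov_sequence u \<longleftrightarrow>
     (\<forall>w. filterlim (\<lambda>(i, j). gromov_product w (u i) (u j)) at_top (sequentially \<times>\<^sub>F sequentially))"

definition gromov_rel :: "((nat \<Rightarrow> 'a::metric_space) \<times> (nat \<Rightarrow> 'a)) set" where
  "gromov_rel = {(u, v). gromov_sequence u \<and> gromov_sequence v \<and>
     (\<forall>w. filterlim (\<lambda>i. gromov_product w (u i) (v i)) at_top sequentially)}"

definition gromov_boundary :: "(nat \<Rightarrow> 'a::metric_space) set set" where
  "gromov_boundary = {u. gromov_sequence u} // gromov_rel"

text \<open>The union is the usual way to define a map on equivalence classes: for a quasi-isometry of a
  hyperbolic space all members of the union coincide.\<close>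

definition boundary_map ::
    "('a::metric_space \<Rightarrow> 'b::metric_space) \<Rightarrow> (nat \<Rightarrow> 'a) set \<Rightarrow> (nat \<Rightarrow> 'b) set" where
  "boundary_map f \<xi> = (\<Union>u\<in>\<xi>. gromov_rel `` {f \<circ> u})"

definition boundary_rigid :: "'a::metric_space itself \<Rightarrow> bool" where
  "boundary_rigid _ \<longleftrightarrow>
     (\<forall>f::'a \<Rightarrow> 'a. quasi_isometry f \<and> (\<forall>\<xi>\<in>gromov_boundary. boundary_map f \<xi> = \<xi>)
        \<longrightarrow> bdd_above (range (\<lambda>x. dist x (f x))))"

text \<open>\<open>Inl x\<close> is the point \<open>x\<close> of the space, \<open>Inr \<xi>\<close> the boundary point \<open>\<xi>\<close>.\<close>

definition gromov_closure :: "('a::metric_space + (nat \<Rightarrow> 'a) set) set" where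
  "gromov_closure = UNIV <+> gromov_boundary"

definition geodesic_connecting ::
    "'a::metric_space set \<Rightarrow> 'a + (nat \<Rightarrow> 'a) set \<Rightarrow> (nat \<Rightarrow> 'a) set \<Rightarrow> bool" where
  "geodesic_connecting G p v \<longleftrightarrow>
     (case p of
        Inl x \<Rightarrow> \<exists>g::real \<Rightarrow> 'a. isometric_on {0..} g \<and> g 0 = x \<and>
                   (\<lambda>n. g (real n)) \<in> v \<and> G = g ` {0..}
      | Inr \<xi> \<Rightarrow> \<exists>g::real \<Rightarrow> 'a. isometric_on UNIV g \<and> (\<lambda>n. g (- real n)) \<in> \<xi> \<and>
                   (\<lambda>n. g (real n)) \<in> v \<and> G = range g)"

definition has_pole :: "'a::metric_space itself \<Rightarrow> bool" where
  "has_pole _ \<longleftrightarrow>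
     (\<exists>L\<ge>0. \<exists>p\<in>gromov_closure. \<forall>x::'a. \<exists>v\<in>gromov_boundary. \<exists>G.
        geodesic_connecting G p v \<and> infdist x G \<le> L)"

section \<open>Visual metrics and uniform perfectness\<close>

definition boundary_product ::
    "'a::metric_space \<Rightarrow> (nat \<Rightarrow> 'a) set \<Rightarrow> (nat \<Rightarrow> 'a) set \<Rightarrow> ereal" where
  "boundary_product w \<xi> \<zeta> =
     (INF (u, v)\<in>\<xi> \<times> \<zeta>. Liminf sequentially (\<lambda>i. ereal (gromov_product w (u i) (v i))))"

text \<open>This is \<open>e\<close> to the power \<open>- \<epsilon> (\<xi>|\<zeta>)\<^sub>w\<close>, with value \<open>0\<close> for infinite product.\<close>

definition visual_weight ::
    "'a::metric_space \<Rightarrow> real \<Rightarrow> (nat \<Rightarrow> 'a) set \<Rightarrow> (nat \<Rightarrow> 'a) set \<Rightarrow> real" where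
  "visual_weight w \<epsilon> \<xi> \<zeta> =
     (if boundary_product w \<xi> \<zeta> = \<infinity> then 0
      else exp (- \<epsilon> * real_of_ereal (boundary_product w \<xi> \<zeta>)))"

definition visual_dist ::
    "'a::metric_space \<Rightarrow> real \<Rightarrow> (nat \<Rightarrow> 'a) set \<Rightarrow> (nat \<Rightarrow> 'a) set \<Rightarrow> real" where
  "visual_dist w \<epsilon> \<xi> \<zeta> =
     Inf {(\<Sum>i=1..n. visual_weight w \<epsilon> (c (i - 1)) (c i)) | n c.
            (n::nat) \<ge> 1 \<and> c 0 = \<xi> \<and> c n = \<zeta> \<and> (\<forall>i\<le>n. c i \<in> gromov_boundary)}"

definition visual_metric ::
    "((nat \<Rightarrow> 'a::metric_space) set \<Rightarrow> (nat \<Rightarrow> 'a) set \<Rightarrow> real) \<Rightarrow> bool" where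
  "visual_metric \<rho> \<longleftrightarrow>
     (\<exists>w \<delta> \<epsilon>. \<delta> > 0 \<and> delta_hyperbolic TYPE('a) \<delta> \<and> delta_thin TYPE('a) \<delta> \<and>
        0 < \<epsilon> \<and> \<epsilon> < min 1 (1 / (5 * \<delta>)) \<and> \<rho> = visual_dist w \<epsilon>)"

definition uniformly_perfect :: "'z set \<Rightarrow> ('z \<Rightarrow> 'z \<Rightarrow> real) \<Rightarrow> bool" where
  "uniformly_perfect Z d \<longleftrightarrow>
     (\<exists>S\<ge>1. \<exists>r0>0. \<forall>x\<in>Z. \<forall>r. 0 < r \<and> r \<le> r0 \<longrightarrow> (\<exists>y\<in>Z. r / S < d x y \<and> d x y \<le> r))"

section \<open>Geodesic richness\<close>

definition bi_infinite_geodesic :: "'a::metric_space set \<Rightarrow> bool" where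
  "bi_infinite_geodesic G \<longleftrightarrow> (\<exists>g::real \<Rightarrow> 'a. isometric_on UNIV g \<and> G = range g)"

definition geodesically_rich :: "'a::metric_space itself \<Rightarrow> bool" where
  "geodesically_rich _ \<longleftrightarrow>
     (\<exists>r0 r1 r2 r3 r4 :: real.
        (\<forall>p q::'a. dist p q \<ge> r0 \<longrightarrow>
           (\<exists>G. bi_infinite_geodesic G \<and> infdist p G < r1 \<and> \<bar>infdist q G - dist p q\<bar> < r2)) \<and>
        (\<forall>G (p::'a). bi_infinite_geodesic G \<longrightarrow>
           (\<exists>G'. bi_infinite_geodesic G' \<and> infdist p G' < r3 \<and>
                 \<bar>infdist p G - setdist G' G\<bar> < r4)))"

section \<open>Existence of visual metrics\<close>

lemma infdist_less_witness:
  assumes "infdist p A < e" "A \<noteq> {}"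
  obtains a where "a \<in> A" "dist p a < e"
  using assms by (auto simp: infdist_def cINF_less_iff)

lemma delta_hyperbolic_imp_thin:
  assumes geo: "geodesic_space TYPE('a::metric_space)"
    and hyp: "delta_hyperbolic TYPE('a) \<delta>" and less: "\<delta> < e"
  shows "delta_thin TYPE('a) (6 * e)"
  unfolding delta_thin_def
proof (intro allI impI ballI, elim conjE)
  fix x y z :: 'a and g h t
  assume g: "geodesic_path g x y" and h: "geodesic_path h x z" and t: "t \<in> {0..gromov_product x y z}"
  obtain k where k: "geodesic_path k y z"
    using geo unfolding geodesic_space_def geodesic_segment_def by metis
  have rev: "geodesic_segment (f ` {0..dist a b}) b a" if f: "geodesic_path f a b"
    for f :: "real \<Rightarrow> 'a" and a b
  proof -
    have "geodesic_path (\<lambda>s. f (dist a b - s)) b a"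
      using f unfolding geodesic_path_def isometric_on_def
      by (auto simp: dist_commute dist_real_def)
    moreover have "f ` {0..dist a b} = (\<lambda>s. f (dist a b - s)) ` {0..dist b a}"
    proof -
      have "{0..dist a b} = (\<lambda>s. dist a b - s) ` {0..dist b a}"
        by (auto simp: dist_commute image_iff intro!: bexI[of _ "dist a b - _"])
      then show ?thesis by (metis image_image)
    qed
    ultimately show ?thesis unfolding geodesic_segment_def by blast
  qed
  have fwd: "geodesic_segment (f ` {0..dist a b}) a b" if "geodesic_path f a b"
    for f :: "real \<Rightarrow> 'a" and a b
    using that unfolding geodesic_segment_def by blast
  have dd: "dist a (f s) = s" "dist b (f s) = dist a b - s"
    if f: "geodesic_path f a b" and s: "s \<in> {0..dist a b}" for f :: "real \<Rightarrow> 'a" and a b s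
  proof -
    have "0 \<in> {0..dist a b}" "dist a b \<in> {0..dist a b}" by auto
    then have "dist (f 0) (f s) = dist 0 s" "dist (f (dist a b)) (f s) = dist (dist a b) s"
      using f s unfolding geodesic_path_def isometric_on_def by blast+
    then show "dist a (f s) = s" "dist b (f s) = dist a b - s"
      using f s unfolding geodesic_path_def by (auto simp: dist_real_def)
  qed
  have T: "gromov_product x y z \<le> dist x y" "gromov_product x y z \<le> dist x z"
    unfolding gromov_product_def
    using dist_triangle[of x z y] dist_triangle[of x y z] dist_triangle[of y x z]
      dist_triangle[of z x y] by (auto simp: dist_commute)
  have tg: "t \<in> {0..dist x y}" and th: "t \<in> {0..dist x z}" using t T by auto
  define A B C where "A = g ` {0..dist x y}" and "B = h ` {0..dist x z}" and "C = k ` {0..dist y z}"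
  have near_p: "infdist (g t) (C \<union> B) \<le> \<delta>"
    using hyp fwd[OF g] fwd[OF k] rev[OF h] tg unfolding delta_hyperbolic_def A_def B_def C_def
    by (metis imageI)
  have near_q: "infdist (h t) (C \<union> A) \<le> \<delta>"
    using hyp fwd[OF h] rev[OF k] rev[OF g] th unfolding delta_hyperbolic_def A_def B_def C_def
    by (metis imageI)
  have ne: "C \<union> B \<noteq> {}" "C \<union> A \<noteq> {}" unfolding A_def B_def C_def by auto
  obtain p' where p': "p' \<in> C \<union> B" "dist (g t) p' < e"
    using infdist_less_witness[of "g t" "C \<union> B" e] near_p less ne by force
  obtain q' where q': "q' \<in> C \<union> A" "dist (h t) q' < e"
    using infdist_less_witness[of "h t" "C \<union> A" e] near_q less ne by force
  have iso: "dist (f s) (f r) = \<bar>s - r\<bar>"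
    if "geodesic_path f a b" "s \<in> {0..dist a b}" "r \<in> {0..dist a b}"
    for f :: "real \<Rightarrow> 'a" and a b s r
    using that unfolding geodesic_path_def isometric_on_def by (auto simp: dist_real_def)
  have e0: "e > 0" using p'(2) zero_le_dist[of "g t" p'] by linarith
  show "dist (g t) (h t) \<le> 6 * e"
  proof (cases "p' \<in> B \<or> q' \<in> A")
    case True
    then show ?thesis
    proof
      assume "p' \<in> B"
      then obtain s where s: "s \<in> {0..dist x z}" "p' = h s" unfolding B_def by auto
      have "\<bar>s - t\<bar> \<le> dist (g t) p'"
        using dd(1)[OF g tg] dd(1)[OF h s(1)] s(2)
          dist_triangle[of x "g t" p'] dist_triangle[of x p' "g t"] by (auto simp: dist_commute)
      moreover have "dist p' (h t) = \<bar>s - t\<bar>" using iso[OF h s(1) th] s(2) by simp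
      ultimately show ?thesis using dist_triangle[of "g t" "h t" p'] p'(2) e0 by linarith
    next
      assume "q' \<in> A"
      then obtain s where s: "s \<in> {0..dist x y}" "q' = g s" unfolding A_def by auto
      have "\<bar>s - t\<bar> \<le> dist (h t) q'"
        using dd(1)[OF h th] dd(1)[OF g s(1)] s(2)
          dist_triangle[of x "h t" q'] dist_triangle[of x q' "h t"] by (auto simp: dist_commute)
      moreover have "dist q' (g t) = \<bar>s - t\<bar>" using iso[OF g s(1) tg] s(2) by simp
      ultimately show ?thesis
        using dist_triangle[of "h t" "g t" q'] q'(2) e0 by (simp add: dist_commute)
    qed
  next
    case False
    then obtain s r where s: "s \<in> {0..dist y z}" "p' = k s" and r: "r \<in> {0..dist y z}" "q' = k r"
      using p'(1) q'(1) unfolding C_def by auto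
    have 1: "dist y p' = s" "dist z p' = dist y z - s" "dist y q' = r" "dist z q' = dist y z - r"
      using dd[OF k s(1)] dd[OF k r(1)] s(2) r(2) by auto
    have 2: "dist x (g t) = t" "dist y (g t) = dist x y - t"
        "dist x (h t) = t" "dist z (h t) = dist x z - t"
      using dd[OF g tg] dd[OF h th] by auto
    have 3: "dist x y \<le> dist x p' + s" "dist x z \<le> dist x p' + (dist y z - s)"
      using dist_triangle[of x y p'] dist_triangle[of x z p'] 1 by (auto simp: dist_commute)
    have 4: "dist x p' < t + e" using dist_triangle[of x p' "g t"] p'(2) 2 by linarith
    have 5: "2 * gromov_product x y z = dist x y + dist x z - dist y z"
      unfolding gromov_product_def by (simp add: dist_commute)
    have 6: "\<bar>s - (dist x y - t)\<bar> \<le> e"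
      using dist_triangle[of y p' "g t"] dist_triangle[of y "g t" p'] p'(2) 1 2
      by (auto simp: dist_commute)
    have 7: "\<bar>(dist y z - r) - (dist x z - t)\<bar> \<le> e"
      using dist_triangle[of z q' "h t"] dist_triangle[of z "h t" q'] q'(2) 1 2
      by (auto simp: dist_commute)
    have "dist p' q' = \<bar>s - r\<bar>" using iso[OF k s(1) r(1)] s(2) r(2) by simp
    also have "\<dots> \<le> 4 * e" using 3 4 5 6 7 t by auto
    finally show ?thesis
      using dist_triangle[of "g t" "h t" p'] dist_triangle[of p' "h t" q'] p'(2) q'(2)
      by (simp add: dist_commute)
  qed
qed

lemma visual_metric_exists:
  assumes "geodesic_space TYPE('a::metric_space)" "gromov_hyperbolic TYPE('a)"
  shows "\<exists>\<rho> :: (nat \<Rightarrow> 'a) set \<Rightarrow> (nat \<Rightarrow> 'a) set \<Rightarrow> real. visual_metric \<rho>"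
proof -
  obtain \<delta> where \<delta>: "\<delta> \<ge> 0" "delta_hyperbolic TYPE('a) \<delta>"
    using assms(2) unfolding gromov_hyperbolic_def by blast
  define D where "D = 6 * (\<delta> + 1)"
  have thin: "delta_thin TYPE('a) D"
    unfolding D_def using delta_hyperbolic_imp_thin[OF assms(1) \<delta>(2), of "\<delta> + 1"] by simp
  have D: "D > 0" "\<delta> \<le> D" using \<delta>(1) by (auto simp: D_def)
  have hyp: "delta_hyperbolic TYPE('a) D"
    using \<delta>(2) D(2) unfolding delta_hyperbolic_def by (meson order_trans)
  have "min 1 (1 / (5 * D)) > 0" using D by simp
  then obtain \<epsilon> where "0 < \<epsilon>" "\<epsilon> < min 1 (1 / (5 * D))" using dense by blast
  then show ?thesis using D(1) hyp thin unfolding visual_metric_def by blast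
qed

end

theory Submission
  imports Defs
begin

text \<open>
  All three properties are equivalent to \<open>branching\<close>: for every boundary point \<open>\<xi>\<close> and every height
  \<open>t\<close> there is a boundary point \<open>\<zeta>\<close> that separates from \<open>\<xi>\<close> at height \<open>t\<close>, that is, \<open>(\<xi>|\<zeta>)\<^sub>w\<close> equals \<open>t\<close> up to
  a constant.  Boundary points are handled through the Gromov sequences that represent them, and
  hyperbolicity enters through the four-point inequality for Gromov products.  The pole
  enters through its consequence that each point of the space lies, up to a constant, on the way
  from \<open>w\<close> to some boundary point (\<open>has_pole_imp_visible_from\<close>).

  Uniform perfectness is branching in disguise, because a visual metric is comparable to
  \<open>exp (- \<epsilon> (\<xi>|\<zeta>)\<^sub>w)\<close> by Frink's chain lemma (\<open>quasimetric_le_chain_sum\<close>, \<open>visual_dist_bounds\<close>).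

  Branching makes every point \<open>x\<close> a coarse centre of a triple of boundary points
  (\<open>branching_imp_coarse_centre\<close>).  This gives rigidity: a quasi-isometry preserves Gromov products
  up to multiplicative and additive constants, by the stability of quasi-geodesics, so if it fixes the
  boundary, it maps \<open>x\<close> to a centre of the same triple, and two such centres are close (\<open>dist_centres_le\<close>).  It also
  gives richness: of the three points at least two lead away from a given point \<open>q\<close>, and a line
  joining these two, obtained from long geodesic segments by compactness, passes near \<open>x\<close> and stays
  away from \<open>q\<close> (\<open>line_away_from_point\<close>).

  Conversely, if branching fails, there are arbitrarily long ranges of heights in which nothing
  separates from some geodesic \<open>\<sigma>\<close>.  By visibility, the space near \<open>\<sigma>\<close> is then an isolated tube, coarsely
  an interval.  Infinitely many such tubes of growing length fit into disjoint spherical shells, and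
  stretching one part of each tube while compressing the rest is a quasi-isometry that
  fixes the boundary and moves points arbitrarily far (\<open>long_tubes_imp_not_boundary_rigid\<close>).  If the
  space is rich, take \<open>p\<close> at height \<open>t\<close> and \<open>q\<close> somewhat higher on the way to \<open>\<xi>\<close>: a line near \<open>p\<close>
  and far from \<open>q\<close> has an end that leaves the direction of \<open>\<xi>\<close> between \<open>p\<close> and \<open>q\<close>
  (\<open>geodesically_rich_imp_branching\<close>).
\<close>

section \<open>Gromov products\<close>

abbreviation gp :: "'a::metric_space \<Rightarrow> 'a \<Rightarrow> 'a \<Rightarrow> real" where
  "gp \<equiv> gromov_product"

lemma gp_commute: "gp w x y = gp w y x"
  by (simp add: gromov_product_def dist_commute)

lemma gp_nonneg: "0 \<le> gp w x y"
  using dist_triangle2[of x y w] by (simp add: gromov_product_def)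

lemma gp_le_dist: "gp w x y \<le> dist w x" "gp w x y \<le> dist w y"
  using dist_triangle[of y w x] dist_triangle[of x w y]
  by (simp_all add: gromov_product_def dist_commute)

lemma gp_self [simp]: "gp w x x = dist w x"
  by (simp add: gromov_product_def dist_commute)

lemma gp_swap: "gp w x y + gp x w y = dist w x"
  by (simp add: gromov_product_def dist_commute field_simps)

lemma gp_rebase: "gp x u v = gp w u v - gp w x u - gp w x v + dist w x"
  by (simp add: gromov_product_def dist_commute field_simps)

lemma gp_change_base: "\<bar>gp w x y - gp w' x y\<bar> \<le> dist w w'"
proof -
  have "\<bar>dist x w - dist x w'\<bar> \<le> dist w w'" "\<bar>dist y w - dist y w'\<bar> \<le> dist w w'"
    by (metis abs_dist_diff_le dist_commute)+
  then show ?thesis unfolding gromov_product_def by (simp add: abs_le_iff field_simps)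
qed

lemma gp_change_arg: "\<bar>gp w x y - gp w x' y\<bar> \<le> dist x x'"
proof -
  have "\<bar>dist x w - dist x' w\<bar> \<le> dist x x'" "\<bar>dist x y - dist x' y\<bar> \<le> dist x x'"
    by (metis abs_dist_diff_le dist_commute)+
  then show ?thesis unfolding gromov_product_def by (simp add: abs_le_iff field_simps)
qed

lemma gp_ge_dist_diff: "dist w x - dist x y \<le> gp w x y"
  using dist_triangle[of x w y] by (simp add: gromov_product_def dist_commute)

text \<open>Together with \<open>dist_tangent_point\<close> below, this identifies Gromov products with distances to
  geodesics up to a constant.\<close>

lemma gp_le_dist_between:
  assumes "dist x p + dist p y = dist x y"
  shows "gp w x y \<le> dist w p"
  using assms dist_triangle[of x w p] dist_triangle[of y w p]
  by (simp add: gromov_product_def dist_commute)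

lemma isometric_on_dist:
  fixes g :: "real \<Rightarrow> 'a::metric_space"
  assumes "isometric_on S g" "s \<in> S" "t \<in> S"
  shows "dist (g s) (g t) = \<bar>s - t\<bar>"
  using assms by (simp add: isometric_on_def dist_real_def)

lemma geodesic_path_dist:
  assumes "geodesic_path g x y" "0 \<le> s" "s \<le> dist x y" "0 \<le> t" "t \<le> dist x y"
  shows "dist (g s) (g t) = \<bar>s - t\<bar>"
  using assms by (auto simp: geodesic_path_def intro!: isometric_on_dist)

lemma geodesic_path_dist_ends:
  assumes "geodesic_path g x y" "0 \<le> s" "s \<le> dist x y"
  shows "dist x (g s) = s" "dist (g s) y = dist x y - s"
proof -
  have "g 0 = x" "g (dist x y) = y" using assms by (auto simp: geodesic_path_def)
  then show "dist x (g s) = s" "dist (g s) y = dist x y - s"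
    using geodesic_path_dist[OF assms(1), of 0 s] geodesic_path_dist[OF assms(1), of s "dist x y"]
      assms by auto
qed

lemma geodesic_path_exists:
  assumes "geodesic_space TYPE('a::metric_space)"
  obtains g where "geodesic_path g (x::'a) y"
  using assms unfolding geodesic_space_def geodesic_segment_def by metis

section \<open>The four-point inequality\<close>

text \<open>Apart from the existence of geodesics, the four-point inequality for Gromov products is the
  only consequence of hyperbolicity that the arguments below use.\<close>

locale hyperbolic_geodesic =
  fixes X :: "'a::metric_space itself" and \<delta> :: real
  assumes geodesic: "geodesic_space TYPE('a)"
    and four_point: "min (gp w (x::'a) y) (gp w y z) - \<delta> \<le> gp w x z"
begin

lemma delta_nonneg: "0 \<le> \<delta>"
  using four_point[of undefined undefined undefined undefined] by simp

lemma geodesic_between: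
  obtains g where "geodesic_path g (x::'a) y"
  using geodesic_path_exists[OF geodesic] .

lemma six_point: "min (gp w (x::'a) y) (min (gp w y z) (gp w z v)) - 2 * \<delta> \<le> gp w x v"
  using four_point[of w x y v] four_point[of w y z v] delta_nonneg by linarith

text \<open>At the point \<open>m\<close> where the inscribed circle of the triangle \<open>q\<close>, \<open>a\<close>, \<open>b\<close> touches the side
  opposite to \<open>q\<close>, the product of \<open>a\<close> and \<open>b\<close> vanishes, and the products of \<open>q\<close> with \<open>a\<close> and
  with \<open>b\<close> are equal; the four-point inequality at \<open>m\<close> therefore bounds this common value.\<close>

lemma dist_tangent_point:
  fixes a b q :: 'a
  assumes g: "geodesic_path g a b"
  shows "dist q (g (gp a q b)) \<le> gp q a b + 2 * \<delta>"
proof -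
  define m where "m = g (gp a q b)"
  have t: "0 \<le> gp a q b" "gp a q b \<le> dist a b" by (simp_all add: gp_nonneg gp_le_dist)
  have m: "dist a m = gp a q b" "dist m b = dist a b - gp a q b"
    using geodesic_path_dist_ends[OF g t] by (auto simp: m_def)
  have "gp m a b = 0" using m by (simp add: gromov_product_def dist_commute)
  then have "min (gp m a q) (gp m q b) \<le> \<delta>" using four_point[of m a q b] by simp
  moreover have "gp m a q = (dist m q - gp q a b) / 2" "gp m q b = (dist m q - gp q a b) / 2"
    using m by (simp_all add: gromov_product_def dist_commute field_simps)
  ultimately show ?thesis by (simp add: m_def dist_commute)
qed

text \<open>Passing from \<open>g t\<close> to \<open>h t\<close> via \<open>x\<close> and \<open>y\<close>, all products based at \<open>w\<close> are at least \<open>t\<close>.\<close>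

lemma geodesics_fellow_travel:
  fixes w x y :: 'a
  assumes g: "geodesic_path g w x" and h: "geodesic_path h w y" and t: "0 \<le> t" "t \<le> gp w x y"
  shows "dist (g t) (h t) \<le> 4 * \<delta>"
proof -
  have tx: "t \<le> dist w x" "t \<le> dist w y" using t gp_le_dist[of w x y] by auto
  have "gp w (g t) x = t" "gp w y (h t) = t"
    using geodesic_path_dist_ends[OF g t(1) tx(1)] geodesic_path_dist_ends[OF h t(1) tx(2)]
    by (simp_all add: gromov_product_def dist_commute)
  then have "t - 2 * \<delta> \<le> gp w (g t) (h t)"
    using six_point[of w "g t" x y "h t"] t by simp
  then show ?thesis
    using geodesic_path_dist_ends[OF g t(1) tx(1)] geodesic_path_dist_ends[OF h t(1) tx(2)]
    by (simp add: gromov_product_def dist_commute)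
qed

end

text \<open>Thinness of a triangle with vertex \<open>w\<close> bounds the distance of points at height \<open>t\<close> on
  geodesics from \<open>w\<close>; comparing three such geodesics at the smaller of the two heights yields the
  inequality with the same constant.\<close>

lemma delta_thin_imp_hyperbolic_geodesic:
  assumes geo: "geodesic_space TYPE('a::metric_space)" and thin: "delta_thin TYPE('a) \<delta>"
  shows "hyperbolic_geodesic TYPE('a) \<delta>"
proof
  fix w x y z :: 'a
  obtain gx gy gz where g: "geodesic_path gx w x" "geodesic_path gy w y" "geodesic_path gz w z"
    using geodesic_path_exists[OF geo] by metis
  define t where "t = min (gp w x y) (gp w y z)"
  have t: "0 \<le> t" "t \<le> dist w x" "t \<le> dist w z" "t \<le> gp w x y" "t \<le> gp w y z"
    unfolding t_def using gp_nonneg[of w x y] gp_nonneg[of w y z] gp_le_dist[of w x y]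
      gp_le_dist[of w y z] by auto
  have "dist (gx t) (gy t) \<le> \<delta>" "dist (gy t) (gz t) \<le> \<delta>"
    using thin g t unfolding delta_thin_def by auto
  then have "dist (gx t) (gz t) \<le> 2 * \<delta>" using dist_triangle[of "gx t" "gz t" "gy t"] by linarith
  moreover have "dist x z \<le> dist x (gx t) + dist (gx t) (gz t) + dist (gz t) z"
    using dist_triangle[of x z "gx t"] dist_triangle[of "gx t" z "gz t"] by linarith
  ultimately show "min (gp w x y) (gp w y z) - \<delta> \<le> gp w x z"
    using geodesic_path_dist_ends[OF g(1) t(1,2)] geodesic_path_dist_ends[OF g(3) t(1,3)]
    unfolding t_def[symmetric] by (simp add: gromov_product_def dist_commute)
qed (rule geo)

section \<open>Gromov sequences\<close>

lemma gromov_sequence_iff: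
  "gromov_sequence u \<longleftrightarrow> (\<forall>M. \<exists>N. \<forall>i\<ge>N. \<forall>j\<ge>N. M \<le> gp w (u i) (u j))"
proof
  assume "gromov_sequence u"
  then show "\<forall>M. \<exists>N. \<forall>i\<ge>N. \<forall>j\<ge>N. M \<le> gp w (u i) (u j)"
    unfolding gromov_sequence_def filterlim_at_top eventually_prod_sequentially by simp blast
next
  assume *: "\<forall>M. \<exists>N. \<forall>i\<ge>N. \<forall>j\<ge>N. M \<le> gp w (u i) (u j)"
  have "\<exists>N. \<forall>i\<ge>N. \<forall>j\<ge>N. M \<le> gp w' (u i) (u j)" for M w'
  proof -
    obtain N where "\<forall>i\<ge>N. \<forall>j\<ge>N. M + dist w w' \<le> gp w (u i) (u j)" using * by blast
    moreover have "gp w (u i) (u j) \<le> gp w' (u i) (u j) + dist w w'" for i j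
      using gp_change_base[of w "u i" "u j" w'] by linarith
    ultimately have "\<forall>i\<ge>N. \<forall>j\<ge>N. M \<le> gp w' (u i) (u j)" by (smt (verit))
    then show ?thesis by blast
  qed
  then show "gromov_sequence u"
    unfolding gromov_sequence_def filterlim_at_top eventually_prod_sequentially by simp blast
qed

lemma gromov_sequenceD:
  assumes "gromov_sequence u"
  obtains N where "\<And>i j. N \<le> i \<Longrightarrow> N \<le> j \<Longrightarrow> M \<le> gp w (u i) (u j)"
  using assms unfolding gromov_sequence_iff[of _ w] by blast

lemma gromov_rel_iff:
  "(u, v) \<in> gromov_rel \<longleftrightarrow> gromov_sequence u \<and> gromov_sequence v \<and>
     (\<forall>M. \<forall>\<^sub>F n in sequentially. M \<le> gp w (u n) (v n))"
proof -
  have "filterlim (\<lambda>n. gp w' (u n) (v n)) at_top sequentially"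
    if *: "\<forall>M. \<forall>\<^sub>F n in sequentially. M \<le> gp w (u n) (v n)" for w'
    unfolding filterlim_at_top
  proof
    fix M
    have "\<forall>\<^sub>F n in sequentially. M + dist w w' \<le> gp w (u n) (v n)" using * by blast
    then show "\<forall>\<^sub>F n in sequentially. M \<le> gp w' (u n) (v n)"
      by eventually_elim (use gp_change_base[of w _ _ w'] in \<open>smt (verit)\<close>)
  qed
  then show ?thesis unfolding gromov_rel_def filterlim_at_top by auto
qed

lemma gromov_relD:
  "(u, v) \<in> gromov_rel \<Longrightarrow> \<forall>\<^sub>F n in sequentially. M \<le> gp w (u n) (v n)"
  using gromov_rel_iff by blast

lemma gromov_sequence_refl: "gromov_sequence u \<Longrightarrow> (u, u) \<in> gromov_rel"
  unfolding gromov_rel_iff[where w = undefined] eventually_sequentially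
  by (metis gromov_sequenceD)

lemma gromov_sequence_eventually_far:
  assumes "gromov_sequence u"
  shows "\<forall>\<^sub>F n in sequentially. M \<le> dist w (u n)"
  using gromov_relD[OF gromov_sequence_refl[OF assms], of M w] by simp

context hyperbolic_geodesic begin

lemma gromov_rel_equiv: "equiv {u::nat \<Rightarrow> 'a. gromov_sequence u} gromov_rel"
proof (rule equivI)
  show "gromov_rel \<subseteq> {u::nat \<Rightarrow> 'a. gromov_sequence u} \<times> {u. gromov_sequence u}"
    by (auto simp: gromov_rel_def)
  show "refl_on {u::nat \<Rightarrow> 'a. gromov_sequence u} gromov_rel"
    by (rule refl_onI) (auto intro: gromov_sequence_refl)
  show "sym (gromov_rel :: ((nat \<Rightarrow> 'a) \<times> (nat \<Rightarrow> 'a)) set)"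
    by (rule symI) (auto simp: gromov_rel_def gp_commute)
  show "trans (gromov_rel :: ((nat \<Rightarrow> 'a) \<times> (nat \<Rightarrow> 'a)) set)"
  proof (rule transI)
    fix u v z :: "nat \<Rightarrow> 'a"
    assume uv: "(u, v) \<in> gromov_rel" and vz: "(v, z) \<in> gromov_rel"
    have "\<forall>\<^sub>F n in sequentially. M \<le> gp undefined (u n) (z n)" for M
      using gromov_relD[OF uv, of "M + \<delta>" undefined] gromov_relD[OF vz, of "M + \<delta>" undefined]
      by eventually_elim
        (use four_point[of undefined] in \<open>smt (verit)\<close>)
    then show "(u, z) \<in> gromov_rel"
      using uv vz unfolding gromov_rel_iff[where w = undefined] by blast
  qed
qed

lemma gromov_boundaryE:
  assumes "\<xi> \<in> (gromov_boundary :: (nat \<Rightarrow> 'a) set set)"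
  obtains u where "gromov_sequence u" "\<xi> = gromov_rel `` {u}" "u \<in> \<xi>"
  using assms gromov_sequence_refl unfolding gromov_boundary_def by (auto elim!: quotientE)

lemma gromov_class_in_boundary:
  "gromov_sequence u \<Longrightarrow> gromov_rel `` {u} \<in> (gromov_boundary :: (nat \<Rightarrow> 'a) set set)"
  unfolding gromov_boundary_def by (rule quotientI) simp

lemma boundary_points_related:
  assumes "\<xi> \<in> (gromov_boundary :: (nat \<Rightarrow> 'a) set set)" "u \<in> \<xi>" "v \<in> \<xi>"
  shows "(u, v) \<in> gromov_rel"
  using assms quotient_eq_iff[OF gromov_rel_equiv] unfolding gromov_boundary_def by blast

lemma boundary_point_closed:
  assumes "\<xi> \<in> (gromov_boundary :: (nat \<Rightarrow> 'a) set set)" "u \<in> \<xi>" "(u, v) \<in> gromov_rel"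
  shows "v \<in> \<xi>"
  using assms in_quotient_imp_closed[OF gromov_rel_equiv] unfolding gromov_boundary_def by blast

lemma gromov_rel_cross:
  assumes "((u::nat \<Rightarrow> 'a), v) \<in> gromov_rel"
  obtains N where "\<And>i j. N \<le> i \<Longrightarrow> N \<le> j \<Longrightarrow> M \<le> gp w (u i) (v j)"
proof -
  obtain N1 where N1: "\<And>i. N1 \<le> i \<Longrightarrow> M + \<delta> \<le> gp w (u i) (v i)"
    using gromov_relD[OF assms, of "M + \<delta>" w] unfolding eventually_sequentially by blast
  have "gromov_sequence v" using assms by (simp add: gromov_rel_def)
  then obtain N2 where N2: "\<And>i j. N2 \<le> i \<Longrightarrow> N2 \<le> j \<Longrightarrow> M + \<delta> \<le> gp w (v i) (v j)"
    using gromov_sequenceD by blast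
  have "M \<le> gp w (u i) (v j)" if "max N1 N2 \<le> i" "max N1 N2 \<le> j" for i j
    using N1[of i] N2[of i j] that four_point[of w "u i" "v i" "v j"] by simp
  then show thesis using that by blast
qed

text \<open>Far out, members of equivalent Gromov sequences have large products, so exchanging one for
  the other costs one \<open>\<delta>\<close> in each argument.  Hence products along two Gromov sequences converge up
  to \<open>2\<delta>\<close>, and what holds frequently for some representatives holds eventually for all.\<close>

lemma gp_frequently_less_imp_eventually:
  assumes u: "((u'::nat \<Rightarrow> 'a), u) \<in> gromov_rel" and v: "(v', v) \<in> gromov_rel"
    and less: "\<exists>\<^sub>F n in sequentially. gp w (u' n) (v' n) < c"
  shows "\<forall>\<^sub>F n in sequentially. gp w (u n) (v n) < c + 2 * \<delta>"
proof -
  obtain N1 where N1: "\<And>i j. N1 \<le> i \<Longrightarrow> N1 \<le> j \<Longrightarrow> c + 2 * \<delta> \<le> gp w (u' i) (u j)"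
    using gromov_rel_cross[OF u] by blast
  obtain N2 where N2: "\<And>i j. N2 \<le> i \<Longrightarrow> N2 \<le> j \<Longrightarrow> c + 2 * \<delta> \<le> gp w (v' i) (v j)"
    using gromov_rel_cross[OF v] by blast
  obtain i where i: "max N1 N2 \<le> i" "gp w (u' i) (v' i) < c"
    using less unfolding frequently_sequentially by blast
  have "gp w (u n) (v n) < c + 2 * \<delta>" if "max N1 N2 \<le> n" for n
    using N1[of i n] N2[of i n] six_point[of w "u' i" "u n" "v n" "v' i"] i that delta_nonneg
    by (simp add: gp_commute[of w "v n"])
  then show ?thesis unfolding eventually_sequentially by blast
qed

lemma gp_frequently_greater_imp_eventually:
  assumes u: "((u'::nat \<Rightarrow> 'a), u) \<in> gromov_rel" and v: "(v', v) \<in> gromov_rel"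
    and greater: "\<exists>\<^sub>F n in sequentially. c < gp w (u' n) (v' n)"
  shows "\<forall>\<^sub>F n in sequentially. c - 2 * \<delta> < gp w (u n) (v n)"
proof -
  obtain N1 where N1: "\<And>i j. N1 \<le> i \<Longrightarrow> N1 \<le> j \<Longrightarrow> c + 1 \<le> gp w (u' i) (u j)"
    using gromov_rel_cross[OF u] by blast
  obtain N2 where N2: "\<And>i j. N2 \<le> i \<Longrightarrow> N2 \<le> j \<Longrightarrow> c + 1 \<le> gp w (v' i) (v j)"
    using gromov_rel_cross[OF v] by blast
  obtain i where i: "max N1 N2 \<le> i" "c < gp w (u' i) (v' i)"
    using greater unfolding frequently_sequentially by blast
  have "c - 2 * \<delta> < gp w (u n) (v n)" if "max N1 N2 \<le> n" for n
    using N1[of i n] N2[of i n] six_point[of w "u n" "u' i" "v' i" "v n"] i that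
    by (simp add: gp_commute[of w "u n"])
  then show ?thesis unfolding eventually_sequentially by blast
qed

text \<open>The two ends of a line have product \<open>0\<close> at each point of the line, so at most one of
  them leads towards \<open>a\<close>.  The products with the points of one end are monotone, which makes the
  choice of the end independent of how far out the points are taken.\<close>

lemma line_end_away_from_point:
  fixes g :: "real \<Rightarrow> 'a"
  assumes g: "isometric_on UNIV g"
  obtains \<sigma> :: real where "\<sigma> = 1 \<or> \<sigma> = -1"
    "\<And>n::nat. \<bar>s\<bar> \<le> real n \<Longrightarrow> gp (g s) a (g (\<sigma> * real n)) \<le> \<delta>"
proof -
  have mono: "gp (g s) a (g (\<sigma> * real n)) \<le> gp (g s) a (g (\<sigma> * real m))"
    if "\<sigma> = 1 \<or> \<sigma> = -1" "\<bar>s\<bar> \<le> real n" "n \<le> m" for \<sigma> n m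
  proof -
    have "dist (g (\<sigma> * real n)) (g (\<sigma> * real m)) = real m - real n"
         "dist (g s) (g (\<sigma> * real n)) = real n - \<sigma> * s"
         "dist (g s) (g (\<sigma> * real m)) = real m - \<sigma> * s"
      using that by (auto simp: isometric_on_dist[OF g])
    then show ?thesis
      using dist_triangle[of a "g (\<sigma> * real m)" "g (\<sigma> * real n)"]
      by (simp add: gromov_product_def dist_commute)
  qed
  have opp: "min (gp (g s) a (g (1 * real n))) (gp (g s) a (g (-1 * real n))) \<le> \<delta>"
    if "\<bar>s\<bar> \<le> real n" for n
  proof -
    have "gp (g s) (g (real n)) (g (- real n)) = 0"
      using that by (simp add: gromov_product_def isometric_on_dist[OF g])
    then show ?thesis
      using four_point[of "g s" "g (real n)" a "g (- real n)"] by (simp add: gp_commute)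
  qed
  show thesis
  proof (cases "\<forall>n::nat. \<bar>s\<bar> \<le> real n \<longrightarrow> gp (g s) a (g (1 * real n)) \<le> \<delta>")
    case True
    then show ?thesis using that[of 1] by blast
  next
    case False
    then obtain n where n: "\<bar>s\<bar> \<le> real n" "\<delta> < gp (g s) a (g (1 * real n))" by fastforce
    have "gp (g s) a (g (-1 * real m)) \<le> \<delta>" if m: "\<bar>s\<bar> \<le> real m" for m
    proof -
      define k where "k = max m n"
      have k: "\<bar>s\<bar> \<le> real k" "m \<le> k" "n \<le> k" using m by (auto simp: k_def)
      have "\<delta> < gp (g s) a (g (1 * real k))" using mono[of 1 n k] n k by simp
      then show ?thesis using opp[OF k(1)] mono[of "-1" m k] m k by linarith
    qed
    then show ?thesis using that[of "-1"] by blast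
  qed
qed

lemma line_end_gromov_sequence:
  fixes g :: "real \<Rightarrow> 'a"
  assumes "\<And>i j::nat. dist (g (\<sigma> * real i)) (g (\<sigma> * real j)) = \<bar>real i - real j\<bar>"
  shows "gromov_sequence (\<lambda>n. g (\<sigma> * real n))"
  unfolding gromov_sequence_iff[of _ "g 0"]
proof
  fix M :: real
  obtain N :: nat where N: "M \<le> real N" using real_arch_simple by blast
  have "M \<le> gp (g 0) (g (\<sigma> * real i)) (g (\<sigma> * real j))" if "N \<le> i" "N \<le> j" for i j
    using assms[of i 0] assms[of j 0] assms[of i j] that N by (simp add: gromov_product_def)
  then show "\<exists>N. \<forall>i\<ge>N. \<forall>j\<ge>N. M \<le> gp (g 0) (g (\<sigma> * real i)) (g (\<sigma> * real j))" by blast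
qed

end

section \<open>Branching, visibility and poles\<close>

text \<open>Uniform perfectness of the boundary in terms of Gromov products: at every height \<open>t\<close> above \<open>w\<close>
  some boundary point separates from the one given by \<open>u\<close>.\<close>

definition branching :: "'a::metric_space \<Rightarrow> real \<Rightarrow> bool" where
  "branching w A \<longleftrightarrow>
     (\<forall>u. gromov_sequence u \<longrightarrow> (\<forall>t\<ge>0. \<exists>v. gromov_sequence v \<and>
        (\<forall>\<^sub>F n in sequentially. \<bar>gp w (u n) (v n) - t\<bar> \<le> A)))"

text \<open>Up to a constant, \<open>x\<close> lies on the way from \<open>w\<close> to some boundary point; such spaces are also
  called roughly starlike.  The formulation with sequences applies to poles in the space and to poles
  at infinity alike, and makes the choice of \<open>w\<close> immaterial.\<close>

definition visible_from :: "'a::metric_space \<Rightarrow> real \<Rightarrow> bool" where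
  "visible_from w L \<longleftrightarrow>
     (\<forall>x. \<exists>u. gromov_sequence u \<and> (\<forall>\<^sub>F n in sequentially. dist w x - L \<le> gp w x (u n)))"

lemma visible_from_change_base:
  fixes w w' :: "'a::metric_space"
  assumes "visible_from w L"
  shows "visible_from w' (L + 2 * dist w w')"
  unfolding visible_from_def
proof
  fix x :: 'a
  obtain u where u: "gromov_sequence u" "\<forall>\<^sub>F n in sequentially. dist w x - L \<le> gp w x (u n)"
    using assms unfolding visible_from_def by blast
  have "\<forall>\<^sub>F n in sequentially. dist w' x - (L + 2 * dist w w') \<le> gp w' x (u n)"
    using u(2)
  proof eventually_elim
    case (elim n)
    then show ?case
      using gp_change_base[of w x "u n" w'] dist_triangle[of w' x w] by (simp add: dist_commute)
  qed
  then show "\<exists>u. gromov_sequence u \<and>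
      (\<forall>\<^sub>F n in sequentially. dist w' x - (L + 2 * dist w w') \<le> gp w' x (u n))"
    using u(1) by blast
qed

context hyperbolic_geodesic begin

text \<open>A pole at infinity makes the space visible from every point as well: each point of a line
  can be seen from \<open>w\<close> by looking at one of the two ends of the line.\<close>

lemma has_pole_imp_visible_from:
  assumes "has_pole TYPE('a)"
  shows "\<exists>L. visible_from (w::'a) L"
proof -
  obtain L p where L: "L \<ge> 0" and p: "\<And>x::'a. \<exists>v\<in>gromov_boundary. \<exists>G.
        geodesic_connecting G p v \<and> infdist x G \<le> L"
    using assms unfolding has_pole_def by blast
  show ?thesis
  proof (cases p)
    case (Inl o')
    have "visible_from o' (2 * (L + 1))"
      unfolding visible_from_def
    proof
      fix x :: 'a
      obtain v G g where G: "infdist x G \<le> L" and g: "isometric_on {0..} g" "g 0 = o'"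
        "G = g ` {0::real..}"
        using p[of x] unfolding geodesic_connecting_def Inl by auto
      obtain s where s: "0 \<le> s" "dist x (g s) < L + 1"
      proof -
        have "infdist x G < L + 1" "G \<noteq> {}" using G g(3) by auto
        then obtain y where "y \<in> G" "dist x y < L + 1" using infdist_less_witness by blast
        then show ?thesis using that g(3) by auto
      qed
      have "gromov_sequence (\<lambda>n. g (1 * real n))"
        by (rule line_end_gromov_sequence) (simp add: isometric_on_dist[OF g(1)])
      moreover obtain N :: nat where N: "s \<le> real N" using real_arch_simple by blast
      have "dist o' x - 2 * (L + 1) \<le> gp o' x (g (1 * real n))" if n: "N \<le> n" for n
      proof -
        have "s \<le> real n" using N n by linarith
        then have "gp o' (g s) (g (real n)) = s"
          using s(1) unfolding g(2)[symmetric] gromov_product_def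
          by (simp add: isometric_on_dist[OF g(1)])
        moreover have "dist o' (g s) = s"
          using s(1) unfolding g(2)[symmetric] by (simp add: isometric_on_dist[OF g(1)])
        ultimately show ?thesis
          using gp_change_arg[of o' x "g (real n)" "g s"] s(2) dist_triangle[of o' x "g s"]
          by (simp add: dist_commute)
      qed
      then have "\<forall>\<^sub>F n in sequentially. dist o' x - 2 * (L + 1) \<le> gp o' x (g (1 * real n))"
        unfolding eventually_sequentially by blast
      ultimately show "\<exists>u. gromov_sequence u \<and>
          (\<forall>\<^sub>F n in sequentially. dist o' x - 2 * (L + 1) \<le> gp o' x (u n))"
        by blast
    qed
    then show ?thesis using visible_from_change_base by blast
  next
    case (Inr \<xi>)
    have "visible_from w (\<delta> + 2 * (L + 1))"
      unfolding visible_from_def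
    proof
      fix x :: 'a
      obtain v G g where G: "infdist x G \<le> L" and g: "isometric_on UNIV g" "G = range (g :: real \<Rightarrow> 'a)"
        using p[of x] unfolding geodesic_connecting_def Inr by auto
      obtain s where s: "dist x (g s) < L + 1"
      proof -
        have "infdist x G < L + 1" "G \<noteq> {}" using G g(2) by auto
        then obtain y where "y \<in> G" "dist x y < L + 1" using infdist_less_witness by blast
        then show ?thesis using that g(2) by blast
      qed
      obtain \<sigma> :: real where \<sigma>: "\<sigma> = 1 \<or> \<sigma> = -1"
          "\<And>n::nat. \<bar>s\<bar> \<le> real n \<Longrightarrow> gp (g s) w (g (\<sigma> * real n)) \<le> \<delta>"
        using line_end_away_from_point[OF g(1), of s w] by blast
      have "gromov_sequence (\<lambda>n. g (\<sigma> * real n))"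
        by (rule line_end_gromov_sequence) (rule disjE[OF \<sigma>(1)]; simp add: isometric_on_dist[OF g(1)])
      moreover obtain N :: nat where N: "\<bar>s\<bar> \<le> real N" using real_arch_simple by blast
      have "dist w x - (\<delta> + 2 * (L + 1)) \<le> gp w x (g (\<sigma> * real n))" if n: "N \<le> n" for n
      proof -
        have "\<bar>s\<bar> \<le> real n" using N n by linarith
        then have "dist w (g s) - \<delta> \<le> gp w (g s) (g (\<sigma> * real n))"
          using \<sigma>(2)[of n] gp_swap[of w "g s" "g (\<sigma> * real n)"] by linarith
        then show ?thesis
          using gp_change_arg[of w x "g (\<sigma> * real n)" "g s"] s dist_triangle[of w x "g s"]
          by (simp add: dist_commute)
      qed
      then have "\<forall>\<^sub>F n in sequentially. dist w x - (\<delta> + 2 * (L + 1)) \<le> gp w x (g (\<sigma> * real n))"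
        unfolding eventually_sequentially by blast
      ultimately show "\<exists>u. gromov_sequence u \<and>
          (\<forall>\<^sub>F n in sequentially. dist w x - (\<delta> + 2 * (L + 1)) \<le> gp w x (u n))"
        by blast
    qed
    then show ?thesis by blast
  qed
qed

end

section \<open>Visual metrics and uniform perfectness\<close>

text \<open>Frink's chain lemma: splitting a chain at the middle of its total weight, both halves and
  the link between them are controlled by the total weight, so that no constant is lost in the
  induction as long as \<open>K\<^sup>2 \<le> 2\<close>.\<close>

lemma quasimetric_le_chain_sum:
  fixes \<rho> :: "'z \<Rightarrow> 'z \<Rightarrow> real" and c :: "nat \<Rightarrow> 'z"
  assumes nonneg: "\<And>x y. 0 \<le> \<rho> x y" and refl: "\<And>x. x \<in> Z \<Longrightarrow> \<rho> x x = 0"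
    and quasi: "\<And>x y z. x \<in> Z \<Longrightarrow> y \<in> Z \<Longrightarrow> z \<in> Z \<Longrightarrow> \<rho> x z \<le> K * max (\<rho> x y) (\<rho> y z)"
    and K: "1 \<le> K" "K * K \<le> 2" and c: "\<And>i. i \<le> n \<Longrightarrow> c i \<in> Z"
  shows "\<rho> (c 0) (c n) \<le> 2 * (\<Sum>i<n. \<rho> (c i) (c (Suc i)))"
  using c
proof (induction n arbitrary: c rule: less_induct)
  case (less n)
  define S where "S = (\<Sum>i<n. \<rho> (c i) (c (Suc i)))"
  have S0: "0 \<le> S" unfolding S_def by (intro sum_nonneg nonneg)
  show ?case
  proof (cases "n = 0")
    case True
    then show ?thesis using refl less.prems[of 0] by simp
  next
    case False
    let ?P = "\<lambda>k. S / 2 \<le> (\<Sum>i<Suc k. \<rho> (c i) (c (Suc i)))"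
    define k where "k = (LEAST k. ?P k)"
    have n1: "?P (n - 1)" using False S0 by (simp add: S_def)
    have k: "?P k" "k \<le> n - 1" unfolding k_def using n1 by (rule LeastI, rule Least_le)
    have kn: "k < n" using k(2) False by simp
    have before: "(\<Sum>i<k. \<rho> (c i) (c (Suc i))) \<le> S / 2"
    proof (cases k)
      case 0
      then show ?thesis using S0 by simp
    next
      case (Suc j)
      then have "\<not> ?P j" using not_less_Least[of j ?P] unfolding k_def[symmetric] by simp
      then show ?thesis unfolding Suc by linarith
    qed
    have split: "S = (\<Sum>i<Suc k. \<rho> (c i) (c (Suc i)))
        + (\<Sum>i<n - Suc k. \<rho> (c (Suc k + i)) (c (Suc (Suc k + i))))"
    proof -
      let ?f = "\<lambda>i. \<rho> (c i) (c (Suc i))"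
      have "S = sum ?f {0..<Suc k} + sum ?f {Suc k..<n}"
        unfolding S_def lessThan_atLeast0 using kn by (intro sum.atLeastLessThan_concat[symmetric]) auto
      also have "sum ?f {Suc k..<n} = sum (?f \<circ> (+) (Suc k)) {0..<n - Suc k}"
        by (rule sum.atLeastLessThan_shift_0)
      finally show ?thesis by (simp only: lessThan_atLeast0 o_def)
    qed
    have a: "\<rho> (c 0) (c k) \<le> S"
      using less.IH[of k c] kn less.prems before by fastforce
    have b: "\<rho> (c k) (c (Suc k)) \<le> S"
    proof -
      have "(\<Sum>i\<in>{k}. \<rho> (c i) (c (Suc i))) \<le> S"
        unfolding S_def by (rule sum_mono2) (use kn nonneg in auto)
      then show ?thesis by simp
    qed
    have d: "\<rho> (c (Suc k)) (c n) \<le> S"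
      using less.IH[of "n - Suc k" "\<lambda>i. c (Suc k + i)"] kn less.prems k(1) split by simp
    have mem: "c 0 \<in> Z" "c k \<in> Z" "c (Suc k) \<in> Z" "c n \<in> Z" using less.prems kn by auto
    have "\<rho> (c k) (c n) \<le> K * max (\<rho> (c k) (c (Suc k))) (\<rho> (c (Suc k)) (c n))"
      using quasi mem by blast
    also have "\<dots> \<le> K * S" using b d K(1) by (intro mult_left_mono) auto
    finally have e: "\<rho> (c k) (c n) \<le> K * S" .
    have "\<rho> (c 0) (c n) \<le> K * max (\<rho> (c 0) (c k)) (\<rho> (c k) (c n))"
      using quasi mem by blast
    also have "\<dots> \<le> K * (K * S)"
      using a e K(1) S0 mult_right_mono[of 1 K S] by (intro mult_left_mono) auto
    also have "\<dots> \<le> 2 * S"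
      using mult_right_mono[OF K(2) S0] by (simp add: mult.assoc)
    finally show ?thesis unfolding S_def .
  qed
qed

lemma boundary_product_geI:
  assumes "\<And>u v. u \<in> \<xi> \<Longrightarrow> v \<in> \<zeta> \<Longrightarrow> \<forall>\<^sub>F n in sequentially. M \<le> gp w (u n) (v n)"
  shows "ereal M \<le> boundary_product w \<xi> \<zeta>"
  unfolding boundary_product_def
  by (rule INF_greatest) (auto intro!: Liminf_bounded assms)

lemma boundary_product_nonneg: "0 \<le> boundary_product w \<xi> \<zeta>"
  using boundary_product_geI[of \<xi> \<zeta> 0 w] by (simp add: gp_nonneg zero_ereal_def)

lemma boundary_product_greaterD:
  assumes "ereal M < boundary_product w \<xi> \<zeta>" "u \<in> \<xi>" "v \<in> \<zeta>"
  shows "\<forall>\<^sub>F n in sequentially. M < gp w (u n) (v n)"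
proof -
  have "boundary_product w \<xi> \<zeta> \<le> Liminf sequentially (\<lambda>i. ereal (gp w (u i) (v i)))"
    unfolding boundary_product_def using assms(2,3) by (auto intro: INF_lower2)
  then have "ereal M < Liminf sequentially (\<lambda>i. ereal (gp w (u i) (v i)))"
    using assms(1) by order
  then show ?thesis using less_LiminfD by fastforce
qed

lemma boundary_product_leI:
  assumes "u \<in> \<xi>" "v \<in> \<zeta>" "\<forall>\<^sub>F n in sequentially. gp w (u n) (v n) \<le> M"
  shows "boundary_product w \<xi> \<zeta> \<le> ereal M"
proof (rule ccontr)
  assume "\<not> ?thesis"
  then have "\<forall>\<^sub>F n in sequentially. M < gp w (u n) (v n)"
    using boundary_product_greaterD assms(1,2) by (metis not_le)
  then have "\<forall>\<^sub>F n in sequentially. False" using assms(3) by eventually_elim simp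
  then show False by simp
qed

lemma boundary_product_lessD:
  assumes "boundary_product w \<xi> \<zeta> < ereal M"
  obtains u v where "u \<in> \<xi>" "v \<in> \<zeta>" "\<exists>\<^sub>F n in sequentially. gp w (u n) (v n) < M"
proof -
  have "\<not> (\<forall>u\<in>\<xi>. \<forall>v\<in>\<zeta>. \<forall>\<^sub>F n in sequentially. M \<le> gp w (u n) (v n))"
    using boundary_product_geI[of \<xi> \<zeta> M w] assms by (meson not_le)
  then show thesis using that by (auto simp: not_eventually not_le)
qed

lemma visual_weight_nonneg: "0 \<le> visual_weight w \<epsilon> \<xi> \<zeta>"
  by (simp add: visual_weight_def)

lemma visual_weight_le_iff:
  assumes "0 < \<epsilon>"
  shows "visual_weight w \<epsilon> \<xi> \<zeta> \<le> exp (- \<epsilon> * M) \<longleftrightarrow> ereal M \<le> boundary_product w \<xi> \<zeta>"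
  using boundary_product_nonneg[of w \<xi> \<zeta>] assms
  by (cases "boundary_product w \<xi> \<zeta>") (auto simp: visual_weight_def)

lemma visual_weight_geI:
  assumes "0 < \<epsilon>" "boundary_product w \<xi> \<zeta> \<le> ereal M"
  shows "exp (- \<epsilon> * M) \<le> visual_weight w \<epsilon> \<xi> \<zeta>"
  using boundary_product_nonneg[of w \<xi> \<zeta>] assms
  by (cases "boundary_product w \<xi> \<zeta>") (auto simp: visual_weight_def)

context hyperbolic_geodesic begin

text \<open>Taking the infimum over representatives costs nothing, since one sequence \<open>y\<close> representing \<open>\<eta>\<close>
  can be inserted between any two representatives of \<open>\<xi>\<close> and \<open>\<zeta>\<close>.  Keeping the constant \<open>\<delta>\<close> matters for
  the range of exponents in \<open>visual_dist_bounds\<close>.\<close>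

lemma boundary_product_hyperbolic:
  fixes w :: 'a
  assumes \<eta>: "\<eta> \<in> gromov_boundary"
    and M: "ereal M \<le> boundary_product w \<xi> \<eta>" "ereal M \<le> boundary_product w \<eta> \<zeta>"
  shows "ereal (M - \<delta>) \<le> boundary_product w \<xi> \<zeta>"
proof (rule ccontr)
  assume "\<not> ?thesis"
  then obtain M' where M': "boundary_product w \<xi> \<zeta> < ereal M'" "ereal M' < ereal (M - \<delta>)"
    using ereal_dense2[of "boundary_product w \<xi> \<zeta>" "ereal (M - \<delta>)"] by (auto simp: not_le)
  obtain y where y: "y \<in> \<eta>" using gromov_boundaryE[OF \<eta>] by blast
  obtain u v where uv: "u \<in> \<xi>" "v \<in> \<zeta>" "\<exists>\<^sub>F n in sequentially. gp w (u n) (v n) < M'"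
    using boundary_product_lessD[OF M'(1)] .
  have less: "ereal (M' + \<delta>) < ereal M" using M'(2) by simp
  have "\<forall>\<^sub>F n in sequentially. M' + \<delta> < gp w (u n) (y n)"
       "\<forall>\<^sub>F n in sequentially. M' + \<delta> < gp w (y n) (v n)"
    using boundary_product_greaterD less_le_trans[OF less M(1)] less_le_trans[OF less M(2)]
      uv y by blast+
  then have "\<forall>\<^sub>F n in sequentially. \<not> gp w (u n) (v n) < M'"
  proof eventually_elim
    case (elim n)
    then show ?case using four_point[of w "u n" "y n" "v n"] by linarith
  qed
  then show False using uv(3) by (simp add: frequently_def)
qed

lemma visual_weight_refl:
  assumes "\<xi> \<in> (gromov_boundary :: (nat \<Rightarrow> 'a) set set)"
  shows "visual_weight w \<epsilon> \<xi> \<xi> = 0"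
proof -
  have "ereal M \<le> boundary_product w \<xi> \<xi>" for M
    by (intro boundary_product_geI gromov_relD boundary_points_related[OF assms])
  then have "boundary_product w \<xi> \<xi> = \<infinity>" by (metis ereal_top)
  then show ?thesis by (simp add: visual_weight_def)
qed

lemma visual_weight_quasimetric:
  assumes \<eta>: "\<eta> \<in> (gromov_boundary :: (nat \<Rightarrow> 'a) set set)" and \<epsilon>: "0 < \<epsilon>"
  shows "visual_weight w \<epsilon> \<xi> \<zeta>
    \<le> exp (\<epsilon> * \<delta>) * max (visual_weight w \<epsilon> \<xi> \<eta>) (visual_weight w \<epsilon> \<eta> \<zeta>)"
proof -
  define m where "m = max (visual_weight w \<epsilon> \<xi> \<eta>) (visual_weight w \<epsilon> \<eta> \<zeta>)"
  have le: "visual_weight w \<epsilon> \<xi> \<zeta> \<le> exp (\<epsilon> * \<delta>) * e" if e: "m \<le> e" "0 < e" for e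
  proof -
    define M where "M = - ln e / \<epsilon>"
    have "e = exp (- \<epsilon> * M)" using e \<epsilon> by (simp add: M_def)
    then have "ereal M \<le> boundary_product w \<xi> \<eta>" "ereal M \<le> boundary_product w \<eta> \<zeta>"
      using e(1) visual_weight_le_iff[OF \<epsilon>] by (auto simp: m_def)
    then have "visual_weight w \<epsilon> \<xi> \<zeta> \<le> exp (- \<epsilon> * (M - \<delta>))"
      using boundary_product_hyperbolic[OF \<eta>] visual_weight_le_iff[OF \<epsilon>] by blast
    also have "\<dots> = exp (\<epsilon> * \<delta>) * e"
      unfolding \<open>e = exp (- \<epsilon> * M)\<close> by (simp add: exp_add[symmetric] algebra_simps)
    finally show ?thesis .
  qed
  have "0 \<le> m" using visual_weight_nonneg by (auto simp: m_def le_max_iff_disj)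
  have "visual_weight w \<epsilon> \<xi> \<zeta> \<le> exp (\<epsilon> * \<delta>) * m + r" if "0 < r" for r
    using le[of "m + r / exp (\<epsilon> * \<delta>)"] that \<open>0 \<le> m\<close> by (simp add: distrib_left add_nonneg_pos)
  then show ?thesis unfolding m_def[symmetric] by (rule field_le_epsilon)
qed

text \<open>The bound on the exponent makes the visual weight a quasi-metric with constant
  \<open>K = exp (\<epsilon> * \<delta>)\<close> satisfying \<open>K\<^sup>2 \<le> 2\<close>.\<close>

lemma visual_dist_bounds:
  fixes w :: 'a
  assumes mem: "\<xi> \<in> gromov_boundary" "\<zeta> \<in> gromov_boundary"
    and \<epsilon>: "0 < \<epsilon>" "\<epsilon> * \<delta> < 1 / 5"
  shows "visual_weight w \<epsilon> \<xi> \<zeta> \<le> 2 * visual_dist w \<epsilon> \<xi> \<zeta>"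
    and "visual_dist w \<epsilon> \<xi> \<zeta> \<le> visual_weight w \<epsilon> \<xi> \<zeta>"
proof -
  let ?\<omega> = "visual_weight w \<epsilon>"
  let ?S = "{(\<Sum>i=1..n. ?\<omega> (c (i - 1)) (c i)) | n c.
            (n::nat) \<ge> 1 \<and> c 0 = \<xi> \<and> c n = \<zeta> \<and> (\<forall>i\<le>n. c i \<in> gromov_boundary)}"
  have direct: "?\<omega> \<xi> \<zeta> \<in> ?S"
  proof -
    define c where "c = (\<lambda>i::nat. if i = 0 then \<xi> else \<zeta>)"
    have "?\<omega> \<xi> \<zeta> = (\<Sum>i=1..1. ?\<omega> (c (i - 1)) (c i))" by (simp add: c_def)
    moreover have "c 0 = \<xi>" "c 1 = \<zeta>" "\<forall>i\<le>1. c i \<in> gromov_boundary"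
      using mem by (auto simp: c_def)
    ultimately show ?thesis by blast
  qed
  have low: "?\<omega> \<xi> \<zeta> / 2 \<le> s" if s': "s \<in> ?S" for s
  proof -
    obtain n c where s: "s = (\<Sum>i=1..n::nat. ?\<omega> (c (i - 1)) (c i))"
      and c: "c 0 = \<xi>" "c n = \<zeta>" "\<And>i. i \<le> n \<Longrightarrow> c i \<in> gromov_boundary"
      using s' by blast
    have sq: "exp (\<epsilon> * \<delta>) * exp (\<epsilon> * \<delta>) \<le> (2::real)"
    proof -
      have "exp (\<epsilon> * \<delta>) * exp (\<epsilon> * \<delta>) = exp (2 * (\<epsilon> * \<delta>))" by (simp add: exp_add[symmetric])
      also have "\<dots> \<le> exp (1 / 2)" using \<epsilon> by simp
      also have "\<dots> \<le> 2" using exp_half_le2 by simp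
      finally show ?thesis .
    qed
    have "?\<omega> (c 0) (c n) \<le> 2 * (\<Sum>i<n. ?\<omega> (c i) (c (Suc i)))"
      by (rule quasimetric_le_chain_sum[where Z = gromov_boundary and K = "exp (\<epsilon> * \<delta>)"])
        (use c sq \<epsilon> delta_nonneg visual_weight_nonneg visual_weight_refl visual_weight_quasimetric
          in auto)
    also have "(\<Sum>i<n. ?\<omega> (c i) (c (Suc i))) = s" unfolding s by (simp add: sum.atLeast1_atMost_eq)
    finally show ?thesis using c by simp
  qed
  have "visual_dist w \<epsilon> \<xi> \<zeta> = Inf ?S" by (simp add: visual_dist_def)
  moreover have "?\<omega> \<xi> \<zeta> / 2 \<le> Inf ?S" using direct low by (intro cInf_greatest) blast+
  moreover have "Inf ?S \<le> ?\<omega> \<xi> \<zeta>"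
    using direct low by (intro cInf_lower bdd_belowI[of _ "?\<omega> \<xi> \<zeta> / 2"]) blast+
  ultimately show "?\<omega> \<xi> \<zeta> \<le> 2 * visual_dist w \<epsilon> \<xi> \<zeta>" "visual_dist w \<epsilon> \<xi> \<zeta> \<le> ?\<omega> \<xi> \<zeta>"
    by linarith+
qed

lemma boundary_product_less_imp_eventually:
  fixes w :: 'a
  assumes mem: "\<xi> \<in> gromov_boundary" "\<zeta> \<in> gromov_boundary" "u \<in> \<xi>" "v \<in> \<zeta>"
    and less: "boundary_product w \<xi> \<zeta> < ereal M"
  shows "\<forall>\<^sub>F n in sequentially. gp w (u n) (v n) < M + 2 * \<delta>"
proof -
  obtain u' v' where "u' \<in> \<xi>" "v' \<in> \<zeta>" "\<exists>\<^sub>F n in sequentially. gp w (u' n) (v' n) < M"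
    using boundary_product_lessD[OF less] .
  then show ?thesis
    using gp_frequently_less_imp_eventually boundary_points_related[OF mem(1) _ mem(3)]
      boundary_points_related[OF mem(2) _ mem(4)] by blast
qed

text \<open>The visual metric is comparable to \<open>exp (- \<epsilon> (\<xi>|\<zeta>)\<^sub>w)\<close>, so a boundary point at distance of order
  \<open>r\<close> from \<open>\<xi>\<close> is one that separates from \<open>\<xi>\<close> at height \<open>- ln r / \<epsilon>\<close> up to a constant.\<close>

lemma uniformly_perfect_imp_branching:
  fixes w :: 'a
  assumes \<epsilon>: "0 < \<epsilon>" "\<epsilon> * \<delta> < 1 / 5"
    and up: "uniformly_perfect gromov_boundary (visual_dist w \<epsilon>)"
  shows "\<exists>A. branching w A"
proof -
  obtain S r0 where S: "1 \<le> S" and r0: "0 < r0"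
    and y: "\<And>\<xi> r. \<xi> \<in> gromov_boundary \<Longrightarrow> 0 < r \<Longrightarrow> r \<le> r0 \<Longrightarrow>
              \<exists>\<zeta>\<in>gromov_boundary. r / S < visual_dist w \<epsilon> \<xi> \<zeta> \<and> visual_dist w \<epsilon> \<xi> \<zeta> \<le> r"
    using up unfolding uniformly_perfect_def by meson
  define a b where "a = ln (2 * r0) / \<epsilon>" and "b = ln (r0 / S) / \<epsilon>"
  have "branching w (\<bar>a\<bar> + \<bar>b\<bar> + 1 + 2 * \<delta>)"
    unfolding branching_def
  proof (intro allI impI)
    fix u :: "nat \<Rightarrow> 'a" and t :: real
    assume u: "gromov_sequence u" and t: "0 \<le> t"
    define \<xi> r where "\<xi> = gromov_rel `` {u}" and "r = r0 * exp (- \<epsilon> * t)"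
    have \<xi>: "\<xi> \<in> gromov_boundary" "u \<in> \<xi>"
      using u gromov_class_in_boundary gromov_sequence_refl by (auto simp: \<xi>_def)
    have r: "0 < r" "r \<le> r0" using r0 \<epsilon>(1) t by (auto simp: r_def mult_le_cancel_left1)
    obtain \<zeta> where \<zeta>: "\<zeta> \<in> gromov_boundary"
        "r / S < visual_dist w \<epsilon> \<xi> \<zeta>" "visual_dist w \<epsilon> \<xi> \<zeta> \<le> r"
      using y[OF \<xi>(1) r] by blast
    obtain v where v: "gromov_sequence v" "v \<in> \<zeta>" using gromov_boundaryE[OF \<zeta>(1)] by metis
    have "- \<epsilon> * (t - a) = ln (2 * r0) + - \<epsilon> * t" "- \<epsilon> * (t - b) = ln (r0 / S) + - \<epsilon> * t"
      using \<epsilon>(1) by (simp_all add: a_def b_def right_diff_distrib)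
    then have "exp (- \<epsilon> * (t - a)) = 2 * r" "exp (- \<epsilon> * (t - b)) = r / S"
      using r0 S by (simp_all only: exp_add) (simp_all add: r_def)
    then have "visual_weight w \<epsilon> \<xi> \<zeta> \<le> exp (- \<epsilon> * (t - a))"
        "\<not> visual_weight w \<epsilon> \<xi> \<zeta> \<le> exp (- \<epsilon> * (t - b))"
      using visual_dist_bounds[OF \<xi>(1) \<zeta>(1) \<epsilon>, of w] \<zeta>(2,3) by linarith+
    then have bp: "ereal (t - a) \<le> boundary_product w \<xi> \<zeta>" "boundary_product w \<xi> \<zeta> < ereal (t - b)"
      using visual_weight_le_iff[OF \<epsilon>(1)] by (meson not_le)+
    have "\<forall>\<^sub>F n in sequentially. t - a - 1 < gp w (u n) (v n)"
    proof (rule boundary_product_greaterD[OF _ \<xi>(2) v(2)])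
      have "ereal (t - a - 1) < ereal (t - a)" by simp
      then show "ereal (t - a - 1) < boundary_product w \<xi> \<zeta>" using bp(1) by order
    qed
    moreover have "\<forall>\<^sub>F n in sequentially. gp w (u n) (v n) < t - b + 2 * \<delta>"
      using boundary_product_less_imp_eventually[OF \<xi>(1) \<zeta>(1) \<xi>(2) v(2) bp(2)] .
    ultimately have "\<forall>\<^sub>F n in sequentially. \<bar>gp w (u n) (v n) - t\<bar> \<le> \<bar>a\<bar> + \<bar>b\<bar> + 1 + 2 * \<delta>"
      by eventually_elim (use delta_nonneg in linarith)
    then show "\<exists>v. gromov_sequence v \<and>
        (\<forall>\<^sub>F n in sequentially. \<bar>gp w (u n) (v n) - t\<bar> \<le> \<bar>a\<bar> + \<bar>b\<bar> + 1 + 2 * \<delta>)"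
      using v(1) by blast
  qed
  then show ?thesis by blast
qed

lemma branching_imp_uniformly_perfect:
  fixes w :: 'a
  assumes \<epsilon>: "0 < \<epsilon>" "\<epsilon> * \<delta> < 1 / 5" and br: "branching w A"
  shows "uniformly_perfect gromov_boundary (visual_dist w \<epsilon>)"
proof -
  define B where "B = \<bar>A\<bar> + 2 * \<delta>"
  have B: "0 \<le> B" "0 \<le> \<bar>A\<bar>" using delta_nonneg by (auto simp: B_def)
  \<comment> \<open>A factor \<open>2\<close> is lost to chains; the factor \<open>3\<close> makes the lower bound strict.\<close>
  define S where "S = 3 * exp (\<epsilon> * (B + \<bar>A\<bar>))"
  have "1 \<le> exp (\<epsilon> * (B + \<bar>A\<bar>))" using B \<epsilon>(1) by simp
  then have S: "1 \<le> S" "0 < S" unfolding S_def by linarith+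
  have "\<exists>\<zeta>\<in>gromov_boundary. r / S < visual_dist w \<epsilon> \<xi> \<zeta> \<and> visual_dist w \<epsilon> \<xi> \<zeta> \<le> r"
    if \<xi>: "\<xi> \<in> gromov_boundary" and r: "0 < r" "r \<le> 1" for \<xi> r
  proof -
    obtain u where u: "gromov_sequence u" "u \<in> \<xi>" using gromov_boundaryE[OF \<xi>] by metis
    \<comment> \<open>Separating later by \<open>B\<close> keeps the distance below \<open>r\<close> in spite of the error terms.\<close>
    define t where "t = - ln r / \<epsilon> + B"
    have "ln r / \<epsilon> \<le> 0" using r \<epsilon>(1) by (simp add: divide_nonpos_pos)
    then have t: "0 \<le> t" using B by (simp add: t_def)
    obtain v where v: "gromov_sequence v"
        and uv: "\<forall>\<^sub>F n in sequentially. \<bar>gp w (u n) (v n) - t\<bar> \<le> A"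
      using br u(1) t unfolding branching_def by blast
    define \<zeta> where "\<zeta> = gromov_rel `` {v}"
    have \<zeta>: "\<zeta> \<in> gromov_boundary" "v \<in> \<zeta>"
      using v gromov_class_in_boundary gromov_sequence_refl by (auto simp: \<zeta>_def)
    have "boundary_product w \<xi> \<zeta> \<le> ereal (t + \<bar>A\<bar>)"
    proof (rule boundary_product_leI[OF u(2) \<zeta>(2)])
      show "\<forall>\<^sub>F n in sequentially. gp w (u n) (v n) \<le> t + \<bar>A\<bar>"
        using uv by eventually_elim linarith
    qed
    then have low: "exp (- \<epsilon> * (t + \<bar>A\<bar>)) \<le> visual_weight w \<epsilon> \<xi> \<zeta>"
      using visual_weight_geI[OF \<epsilon>(1)] by blast
    have "ereal (t - B) \<le> boundary_product w \<xi> \<zeta>"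
    proof (rule ccontr)
      assume "\<not> ?thesis"
      then have "boundary_product w \<xi> \<zeta> < ereal (t - B)" by simp
      then have "\<forall>\<^sub>F n in sequentially. gp w (u n) (v n) < t - B + 2 * \<delta>"
        by (rule boundary_product_less_imp_eventually[OF \<xi> \<zeta>(1) u(2) \<zeta>(2)])
      then have "\<forall>\<^sub>F n in sequentially. False" using uv
        by eventually_elim (simp add: B_def)
      then show False by simp
    qed
    then have up: "visual_weight w \<epsilon> \<xi> \<zeta> \<le> exp (- \<epsilon> * (t - B))"
      using visual_weight_le_iff[OF \<epsilon>(1)] by blast
    have e1: "exp (- \<epsilon> * (t - B)) = r"
      using \<epsilon>(1) r by (simp add: t_def)
    have "exp (- \<epsilon> * (t + \<bar>A\<bar>)) = exp (- \<epsilon> * (t - B)) / exp (\<epsilon> * (B + \<bar>A\<bar>))"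
      by (simp add: exp_diff[symmetric] algebra_simps)
    then have "exp (- \<epsilon> * (t + \<bar>A\<bar>)) / 2 = 3 / 2 * (r / S)"
      unfolding e1 S_def by simp
    moreover have "0 < r / S" using r S by simp
    ultimately have "r / S < exp (- \<epsilon> * (t + \<bar>A\<bar>)) / 2" by linarith
    then have "r / S < visual_dist w \<epsilon> \<xi> \<zeta>" "visual_dist w \<epsilon> \<xi> \<zeta> \<le> r"
      using visual_dist_bounds[OF \<xi> \<zeta>(1) \<epsilon>, of w] low up e1 by linarith+
    then show ?thesis using \<zeta>(1) by blast
  qed
  then show ?thesis unfolding uniformly_perfect_def using S(1) zero_less_one by blast
qed

end

section \<open>Triples of boundary points around a centre\<close>

text \<open>Up to constants, \<open>x\<close> is the centre of an ideal triangle: it is at bounded distance from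
  all three sides.\<close>

definition coarse_centre :: "real \<Rightarrow> 'a::metric_space \<Rightarrow> bool" where
  "coarse_centre C x \<longleftrightarrow>
     (\<exists>u v z. gromov_sequence u \<and> gromov_sequence v \<and> gromov_sequence z \<and>
        (\<forall>\<^sub>F n in sequentially. gp x (u n) (v n) \<le> C \<and> gp x (v n) (z n) \<le> C \<and> gp x (u n) (z n) \<le> C))"

context hyperbolic_geodesic begin

text \<open>Seen from \<open>w\<close>, take a boundary point behind \<open>x\<close>, one that branches off from it near \<open>x\<close>,
  and one that branches off a fixed distance \<open>B\<close> behind \<open>x\<close>.  The second point is separated from the
  other two near \<open>x\<close>, and those two separate from each other soon after \<open>x\<close>.\<close>

lemma branching_imp_coarse_centre:
  fixes w x :: 'a
  assumes br: "branching w A" and vis: "visible_from w L"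
  shows "coarse_centre (4 * \<bar>A\<bar> + 2 * \<bar>L\<bar> + 4 * \<delta> + 1) x"
proof -
  define t where "t = dist w x"
  \<comment> \<open>Large enough for \<open>z\<close> to separate from \<open>u\<close> only after \<open>v\<close> has done so.\<close>
  define B where "B = 2 * \<bar>A\<bar> + \<delta> + 1"
  have t: "0 \<le> t" "0 \<le> t + B" using delta_nonneg by (auto simp: t_def B_def)
  obtain u where u: "gromov_sequence u" "\<forall>\<^sub>F n in sequentially. t - L \<le> gp w x (u n)"
    using vis unfolding visible_from_def t_def by blast
  obtain v where v: "gromov_sequence v" "\<forall>\<^sub>F n in sequentially. \<bar>gp w (u n) (v n) - t\<bar> \<le> A"
    using br u(1) t(1) unfolding branching_def by blast
  obtain z where z: "gromov_sequence z" "\<forall>\<^sub>F n in sequentially. \<bar>gp w (u n) (z n) - (t + B)\<bar> \<le> A"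
    using br u(1) t(2) unfolding branching_def by blast
  have "\<forall>\<^sub>F n in sequentially. gp x (u n) (v n) \<le> 4 * \<bar>A\<bar> + 2 * \<bar>L\<bar> + 4 * \<delta> + 1 \<and>
      gp x (v n) (z n) \<le> 4 * \<bar>A\<bar> + 2 * \<bar>L\<bar> + 4 * \<delta> + 1 \<and>
      gp x (u n) (z n) \<le> 4 * \<bar>A\<bar> + 2 * \<bar>L\<bar> + 4 * \<delta> + 1"
    using u(2) v(2) z(2)
  proof eventually_elim
    case (elim n)
    let ?u = "u n" and ?v = "v n" and ?z = "z n"
    have L: "t - \<bar>L\<bar> \<le> gp w x ?u" using elim(1) by linarith
    have xv: "t - \<bar>L\<bar> - \<bar>A\<bar> - \<delta> \<le> gp w x ?v"
      using four_point[of w x ?u ?v] L elim(2) by linarith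
    have xz: "t - \<bar>L\<bar> - \<delta> \<le> gp w x ?z"
      using four_point[of w x ?u ?z] L elim(3) delta_nonneg by (simp add: B_def)
    have vz: "gp w ?v ?z \<le> t + \<bar>A\<bar> + \<delta>"
      using four_point[of w ?v ?z ?u] elim(2,3) gp_commute[of w ?v ?u] gp_commute[of w ?z ?u]
      unfolding B_def by linarith
    note r = gp_rebase[of x ?u ?v w] gp_rebase[of x ?v ?z w] gp_rebase[of x ?u ?z w]
    show ?case using r L xv xz vz elim delta_nonneg unfolding t_def[symmetric] B_def
      by linarith
  qed
  then show ?thesis using u(1) v(1) z(1) unfolding coarse_centre_def by blast
qed

text \<open>Two directions at \<open>x\<close> that both lead towards \<open>y\<close> have a large product with each other.\<close>

lemma two_of_three_away:
  fixes x y :: 'a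
  assumes "gp x u v \<le> C" "gp x v z \<le> C" "gp x u z \<le> C"
  shows "gp x y u \<le> C + \<delta> \<and> gp x y v \<le> C + \<delta> \<or>
         gp x y v \<le> C + \<delta> \<and> gp x y z \<le> C + \<delta> \<or>
         gp x y u \<le> C + \<delta> \<and> gp x y z \<le> C + \<delta>"
  using four_point[of x u y v] four_point[of x v y z] four_point[of x u y z] assms
    gp_commute[of x y u] gp_commute[of x y v] gp_commute[of x y z] by linarith

text \<open>Some point of the triple leads away from \<open>y\<close> at \<open>x\<close> and away from \<open>x\<close> at \<open>y\<close>, and the two
  products involved add up to the distance of \<open>x\<close> and \<open>y\<close>.\<close>

lemma dist_centres_le:
  fixes x y :: 'a
  assumes "gp x u v \<le> C" "gp x v z \<le> C" "gp x u z \<le> C"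
    and "gp y u v \<le> C" "gp y v z \<le> C" "gp y u z \<le> C"
  shows "dist x y \<le> 2 * (C + \<delta>)"
  using two_of_three_away[OF assms(1-3), of y] two_of_three_away[OF assms(4-6), of x]
    gp_swap[of x y u] gp_swap[of x y v] gp_swap[of x y z] by (smt (verit))

end

section \<open>Stability of quasi-geodesics\<close>

text \<open>A quantity bounded by the logarithm of itself is bounded: this closes the estimates in which
  a distance is controlled by the logarithm of the length of a detour.\<close>

lemma logarithmic_self_bound:
  fixes \<alpha> \<beta> \<kappa> \<delta> :: real
  assumes "0 \<le> \<alpha>" "0 \<le> \<delta>"
  shows "\<exists>D0. \<forall>D. (\<forall>N::nat. \<alpha> * D + \<beta> \<le> 2 ^ N \<longrightarrow> D \<le> \<kappa> + real N * \<delta>) \<longrightarrow> D \<le> D0"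
proof -
  define a b where "a = \<alpha> * (\<kappa> + \<delta>) + \<beta>" and "b = \<alpha> * \<delta>"
  have "(\<lambda>n. a / 2 ^ n + b * (real n / 2 ^ n)) \<longlonglongrightarrow> 0 + b * 0"
    by (intro tendsto_intros LIMSEQ_divide_realpow_zero lim_n_over_pown) auto
  then have "\<forall>\<^sub>F n in sequentially. a / 2 ^ n + b * (real n / 2 ^ n) < 1"
    by (rule order_tendstoD) simp
  then obtain N0 where N0: "\<And>n. N0 \<le> n \<Longrightarrow> a / 2 ^ n + b * (real n / 2 ^ n) < 1"
    unfolding eventually_sequentially by blast
  have N0': "a + b * real n < 2 ^ n" if "N0 \<le> n" for n
    using N0[OF that] by (simp add: field_simps)
  have "D \<le> \<kappa> + real N0 * \<delta>"
    if D: "\<And>N::nat. \<alpha> * D + \<beta> \<le> 2 ^ N \<Longrightarrow> D \<le> \<kappa> + real N * \<delta>" for D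
  proof -
    define N where "N = (LEAST N. \<alpha> * D + \<beta> \<le> 2 ^ N)"
    have "\<exists>N. \<alpha> * D + \<beta> \<le> 2 ^ N"
      using real_arch_pow[of 2 "\<alpha> * D + \<beta>"] less_imp_le by auto
    then have N: "\<alpha> * D + \<beta> \<le> 2 ^ N" unfolding N_def by (rule LeastI_ex)
    have "N \<le> N0"
    proof (rule ccontr)
      assume "\<not> N \<le> N0"
      then obtain n where n: "N = Suc n" "N0 \<le> n" by (metis not_less_eq_eq nat.exhaust zero_le)
      have "\<alpha> * D \<le> \<alpha> * (\<kappa> + real (Suc n) * \<delta>)"
        using D[OF N] assms(1) unfolding n(1) by (rule mult_left_mono)
      then have "\<alpha> * D + \<beta> \<le> a + b * real n" by (simp add: a_def b_def algebra_simps)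
      then have "\<alpha> * D + \<beta> \<le> 2 ^ n" using N0'[OF n(2)] by linarith
      then show False using not_less_Least[of n "\<lambda>N. \<alpha> * D + \<beta> \<le> 2 ^ N"] n(1)
        unfolding N_def[symmetric] by simp
    qed
    then have "real N * \<delta> \<le> real N0 * \<delta>" using assms(2) by (simp add: mult_right_mono)
    then show ?thesis using D[OF N] by linarith
  qed
  then show ?thesis by blast
qed

lemma quasi_isometric_embeddingD:
  assumes "quasi_isometric_embedding K C f"
  shows "1 \<le> K" "0 \<le> C" "dist (f x) (f y) \<le> K * dist x y + C"
    "dist x y \<le> K * (dist (f x) (f y) + C)"
proof -
  show K: "1 \<le> K" and "0 \<le> C" and "dist (f x) (f y) \<le> K * dist x y + C"
    using assms by (auto simp: quasi_isometric_embedding_def)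
  have "inverse K * dist x y \<le> dist (f x) (f y) + C"
    using assms by (auto simp: quasi_isometric_embedding_def algebra_simps)
  then show "dist x y \<le> K * (dist (f x) (f y) + C)" using K by (simp add: field_simps)
qed

context hyperbolic_geodesic begin

text \<open>Bisecting a path repeatedly costs one \<open>\<delta>\<close> per step, hence only a logarithmic amount: a long
  path that stays away from \<open>m\<close> keeps the Gromov product of its end points at \<open>m\<close> large.\<close>

lemma gp_ge_of_avoiding_path:
  fixes c :: "real \<Rightarrow> 'a"
  assumes step: "\<And>a b. a \<in> {0..l} \<Longrightarrow> b \<in> {0..l} \<Longrightarrow> \<bar>a - b\<bar> \<le> 1 \<Longrightarrow> dist (c a) (c b) \<le> J"
    and far: "\<And>a. a \<in> {0..l} \<Longrightarrow> R \<le> dist m (c a)"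
    and ab: "a \<in> {0..l}" "b \<in> {0..l}" "\<bar>a - b\<bar> \<le> 2 ^ N"
  shows "R - J - real N * \<delta> \<le> gp m (c a) (c b)"
  using ab
proof (induction N arbitrary: a b)
  case 0
  then show ?case
    using step[of a b] far[of a] gp_ge_dist_diff[of m "c a" "c b"] by simp
next
  case (Suc N)
  define e where "e = (a + b) / 2"
  have "\<bar>a - e\<bar> = \<bar>a - b\<bar> / 2" "\<bar>e - b\<bar> = \<bar>a - b\<bar> / 2" by (auto simp: e_def field_simps)
  then have e: "e \<in> {0..l}" "\<bar>a - e\<bar> \<le> 2 ^ N" "\<bar>e - b\<bar> \<le> 2 ^ N"
    using Suc.prems by (auto simp: e_def)
  show ?case
    using Suc.IH[of a e] Suc.IH[of e b] e Suc.prems four_point[of m "c a" "c e" "c b"]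
    by (simp add: algebra_simps)
qed

text \<open>If a point \<open>m\<close> of the geodesic lay at nearly maximal distance \<open>D\<close> from the quasi-geodesic, then
  the piece of the quasi-geodesic between the points close to those at distance \<open>2D\<close> to
  the left and right of \<open>m\<close> would have length of order \<open>D\<close> and yet avoid the ball of radius \<open>D\<close>
  around \<open>m\<close>.  By the previous lemma this bounds \<open>D\<close> by a logarithm of \<open>D\<close>.\<close>

lemma geodesic_near_quasi_geodesic:
  fixes f :: "'a \<Rightarrow> 'a"
  assumes f: "quasi_isometric_embedding K C f"
  obtains H where "\<And>x y G s. geodesic_path G (f x) (f y) \<Longrightarrow> 0 \<le> s \<Longrightarrow> s \<le> dist (f x) (f y) \<Longrightarrow>
    \<exists>p. dist x p + dist p y = dist x y \<and> dist (G s) (f p) \<le> H"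
proof -
  note K = quasi_isometric_embeddingD(1,2)[OF f]
  define J where "J = K + C"
  define \<kappa> where "\<kappa> = 1 + J + 2 * \<delta>"
  have J0: "0 \<le> J" using K by (simp add: J_def)
  obtain D0 where D0: "\<And>D. (\<And>N::nat. (6 * K) * D + K * (2 + C) \<le> 2 ^ N \<Longrightarrow> D \<le> \<kappa> + real N * \<delta>)
      \<Longrightarrow> D \<le> D0"
    using logarithmic_self_bound[of "6 * K" \<delta> "K * (2 + C)" \<kappa>] K delta_nonneg by auto
  show thesis
  proof (rule that[of "D0 + 1"])
    fix x y G s0
    assume G: "geodesic_path G (f x) (f y)" and s0: "0 \<le> s0" "s0 \<le> dist (f x) (f y)"
    define l l' where "l = dist x y" and "l' = dist (f x) (f y)"
    obtain \<gamma> where \<gamma>: "geodesic_path \<gamma> x y" using geodesic_between .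
    define c where "c = f \<circ> \<gamma>"
    define S where "S = c ` {0..l}"
    have ends: "c 0 = f x" "c l = f y" "G 0 = f x" "G l' = f y"
      using \<gamma> G by (auto simp: geodesic_path_def c_def l_def l'_def)
    have "0 \<le> l" by (simp add: l_def)
    then have S: "f x \<in> S" "f y \<in> S" "S \<noteq> {}" unfolding S_def using ends(1,2) by force+
    have Gd: "dist (G s) (G t) = \<bar>s - t\<bar>" if "s \<in> {0..l'}" "t \<in> {0..l'}" for s t
      using geodesic_path_dist[OF G] that by (simp add: l'_def)
    define D where "D = (SUP s\<in>{0..l'}. infdist (G s) S)"
    have bdd: "bdd_above ((\<lambda>s. infdist (G s) S) ` {0..l'})"
    proof (rule bdd_aboveI2[where M = l'])
      fix s assume s: "s \<in> {0..l'}"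
      have "infdist (G s) S \<le> dist (G s) (f x)" using S(1) by (rule infdist_le)
      also have "\<dots> = s" using Gd[OF s, of 0] s unfolding ends(3) by simp
      finally show "infdist (G s) S \<le> l'" using s by simp
    qed
    have le_D: "infdist (G s) S \<le> D" if "s \<in> {0..l'}" for s
      unfolding D_def using bdd that by (rule cSUP_upper2) simp
    have "l' \<ge> 0" by (simp add: l'_def)
    then have D_nonneg: "0 \<le> D" using le_D[of 0] infdist_nonneg[of "G 0" S] by simp
    have "D \<le> D0"
    proof (rule D0)
      fix N :: nat
      assume N: "(6 * K) * D + K * (2 + C) \<le> 2 ^ N"
      have "\<exists>s\<in>{0..l'}. D - 1 < infdist (G s) S"
        using less_cSUP_iff[of "{0..l'}" "\<lambda>s. infdist (G s) S" "D - 1"] bdd \<open>l' \<ge> 0\<close>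
        unfolding D_def[symmetric] by auto
      then obtain s where s: "s \<in> {0..l'}" "D - 1 < infdist (G s) S" by blast
      have far: "D - 1 \<le> dist (G s) (c a)" if "a \<in> {0..l}" for a
        using infdist_le[of "c a" S "G s"] that s(2) by (simp add: S_def)
      have near: "\<exists>a\<in>{0..l}. dist (G s1) (c a) \<le> D + 1 \<and> D - 1 \<le> gp (G s) (G s1) (c a)"
        if s1: "s1 \<in> {0..l'}" "\<bar>s - s1\<bar> = 2 * D \<or> G s1 \<in> S" for s1
        using s1(2)
      proof
        assume eq: "\<bar>s - s1\<bar> = 2 * D"
        have "infdist (G s1) S < D + 1" using le_D[OF s1(1)] by linarith
        then obtain a where a: "a \<in> {0..l}" "dist (G s1) (c a) < D + 1"
          using infdist_less_witness[OF _ S(3)] unfolding S_def by blast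
        then have "D - 1 \<le> gp (G s) (G s1) (c a)"
          using gp_ge_dist_diff[of "G s" "G s1" "c a"] Gd[OF s(1) s1(1)] eq by linarith
        then show ?thesis using a less_imp_le by blast
      next
        assume "G s1 \<in> S"
        then obtain a where a: "a \<in> {0..l}" "G s1 = c a" by (auto simp: S_def)
        then show ?thesis using far[OF a(1)] D_nonneg by (intro bexI[of _ a]) auto
      qed
      define s1 s2 where "s1 = max 0 (s - 2 * D)" and "s2 = min l' (s + 2 * D)"
      have s12: "s1 \<in> {0..l'}" "s2 \<in> {0..l'}" "s1 \<le> s" "s \<le> s2" "s2 - s1 \<le> 4 * D"
        using s(1) D_nonneg by (auto simp: s1_def s2_def)
      have GS: "G 0 \<in> S" "G l' \<in> S" using S(1,2) ends(3,4) by auto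
      have ends12: "\<bar>s - s1\<bar> = 2 * D \<or> G s1 \<in> S" "\<bar>s - s2\<bar> = 2 * D \<or> G s2 \<in> S"
        using GS D_nonneg unfolding s1_def s2_def max_def min_def by simp_all
      obtain a where a: "a \<in> {0..l}" "dist (G s1) (c a) \<le> D + 1" "D - 1 \<le> gp (G s) (G s1) (c a)"
        using near[OF s12(1) ends12(1)] by blast
      obtain b where b: "b \<in> {0..l}" "dist (G s2) (c b) \<le> D + 1" "D - 1 \<le> gp (G s) (G s2) (c b)"
        using near[OF s12(2) ends12(2)] by blast
      have \<gamma>d: "dist (\<gamma> r) (\<gamma> t) = \<bar>r - t\<bar>" if "r \<in> {0..l}" "t \<in> {0..l}" for r t
        using geodesic_path_dist[OF \<gamma>] that by (simp add: l_def)
      have "dist (c a) (c b) \<le> 6 * D + 2"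
        using dist_triangle[of "c a" "c b" "G s1"] dist_triangle[of "G s1" "c b" "G s2"]
          a(2) b(2) Gd[OF s12(1,2)] s12(3,4,5) by (simp add: dist_commute)
      then have "K * (dist (c a) (c b) + C) \<le> K * ((6 * D + 2) + C)"
        using K by (intro mult_left_mono) auto
      then have "\<bar>a - b\<bar> \<le> (6 * K) * D + K * (2 + C)"
        using quasi_isometric_embeddingD(4)[OF f, of "\<gamma> a" "\<gamma> b"] \<gamma>d[OF a(1) b(1)]
        by (simp add: c_def algebra_simps)
      then have ab: "\<bar>a - b\<bar> \<le> 2 ^ N" using N by linarith
      have step: "dist (c r) (c t) \<le> J" if "r \<in> {0..l}" "t \<in> {0..l}" "\<bar>r - t\<bar> \<le> 1" for r t
      proof -
        have "K * dist (\<gamma> r) (\<gamma> t) \<le> K * 1"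
          using \<gamma>d[OF that(1,2)] that(3) K by (intro mult_left_mono) auto
        then show ?thesis
          using quasi_isometric_embeddingD(3)[OF f, of "\<gamma> r" "\<gamma> t"] by (simp add: c_def J_def)
      qed
      have "D - 1 - J - real N * \<delta> \<le> gp (G s) (c a) (c b)"
        by (rule gp_ge_of_avoiding_path[OF step far a(1) b(1) ab])
      moreover have "gp (G s) (G s1) (G s2) = 0"
        using s12 s(1) Gd by (simp add: gromov_product_def)
      moreover have "0 \<le> real N * \<delta>" using delta_nonneg by simp
      ultimately show "D \<le> \<kappa> + real N * \<delta>"
        using six_point[of "G s" "G s1" "c a" "c b" "G s2"] a(3) b(3) J0
        by (simp add: gp_commute[of "G s" "c b"] \<kappa>_def)
    qed
    then have "infdist (G s0) S < D0 + 1" using le_D[of s0] s0 by (simp add: l'_def)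
    then obtain a where a: "a \<in> {0..l}" "dist (G s0) (c a) < D0 + 1"
      using infdist_less_witness[OF _ S(3)] unfolding S_def by blast
    have "dist x (\<gamma> a) + dist (\<gamma> a) y = dist x y"
      using geodesic_path_dist_ends[OF \<gamma>, of a] a(1) by (simp add: l_def)
    then show "\<exists>p. dist x p + dist p y = dist x y \<and> dist (G s0) (f p) \<le> D0 + 1"
      using a(2) by (intro exI[of _ "\<gamma> a"]) (simp add: c_def less_imp_le)
  qed
qed

section \<open>Boundary rigidity from centres\<close>

text \<open>The point of the geodesic from \<open>f x\<close> to \<open>f y\<close> that realises the product is close to the
  image of a point between \<open>x\<close> and \<open>y\<close>.\<close>

lemma quasi_isometric_embedding_gp_lower:
  fixes f :: "'a \<Rightarrow> 'a"
  assumes f: "quasi_isometric_embedding K C f"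
  obtains B where "\<And>w x y. gp w x y \<le> K * (gp (f w) (f x) (f y) + B)"
proof -
  obtain H where H: "\<And>x y G s. geodesic_path G (f x) (f y) \<Longrightarrow> 0 \<le> s \<Longrightarrow> s \<le> dist (f x) (f y) \<Longrightarrow>
    \<exists>p. dist x p + dist p y = dist x y \<and> dist (G s) (f p) \<le> H"
    using geodesic_near_quasi_geodesic[OF f] by blast
  note K = quasi_isometric_embeddingD(1,2)[OF f]
  have "gp w x y \<le> K * (gp (f w) (f x) (f y) + (2 * \<delta> + H + C))" for w x y
  proof -
    obtain G where G: "geodesic_path G (f x) (f y)" using geodesic_between .
    define m where "m = G (gp (f x) (f w) (f y))"
    have m: "dist (f w) m \<le> gp (f w) (f x) (f y) + 2 * \<delta>"
      unfolding m_def by (rule dist_tangent_point[OF G])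
    obtain p where p: "dist x p + dist p y = dist x y" "dist m (f p) \<le> H"
      using H[OF G gp_nonneg gp_le_dist(2)] unfolding m_def by blast
    have "gp w x y \<le> dist w p" by (rule gp_le_dist_between[OF p(1)])
    also have "\<dots> \<le> K * (dist (f w) (f p) + C)" by (rule quasi_isometric_embeddingD[OF f])
    also have "\<dots> \<le> K * (gp (f w) (f x) (f y) + (2 * \<delta> + H + C))"
      using m p(2) dist_triangle[of "f w" "f p" m] K by (intro mult_left_mono) auto
    finally show ?thesis .
  qed
  then show thesis using that by blast
qed

text \<open>The centre of the image triangle lies close to images of points on all three sides; these
  points are close to each other, so they are near the centre of the original triangle.\<close>

lemma quasi_isometric_embedding_gp_upper:
  fixes f :: "'a \<Rightarrow> 'a"
  assumes f: "quasi_isometric_embedding K C f"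
  obtains B where "\<And>w x y. gp (f w) (f x) (f y) \<le> K * gp w x y + B"
proof -
  obtain H where H: "\<And>x y G s. geodesic_path G (f x) (f y) \<Longrightarrow> 0 \<le> s \<Longrightarrow> s \<le> dist (f x) (f y) \<Longrightarrow>
    \<exists>p. dist x p + dist p y = dist x y \<and> dist (G s) (f p) \<le> H"
    using geodesic_near_quasi_geodesic[OF f] by blast
  note K = quasi_isometric_embeddingD(1,2)[OF f]
  define R where "R = K * (2 * H + 4 * \<delta> + C)"
  have "gp (f w) (f x) (f y) \<le> K * gp w x y + (H + K * (2 * R) + C)" for w x y
  proof -
    obtain Gx Gy Gw where G: "geodesic_path Gx (f x) (f w)" "geodesic_path Gy (f y) (f w)"
        "geodesic_path Gw (f x) (f y)"
      using geodesic_between by metis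
    define m nx ny where "m = Gw (gp (f x) (f w) (f y))" and "nx = Gx (gp (f x) (f w) (f y))"
      and "ny = Gy (gp (f y) (f x) (f w))"
    have m_nx: "dist nx m \<le> 4 * \<delta>"
      unfolding m_def nx_def by (rule geodesics_fellow_travel[OF G(1,3) gp_nonneg order_refl])
    have m_ny: "dist m ny \<le> 4 * \<delta>"
    proof -
      let ?d = "dist (f x) (f y)"
      define h where "h = (\<lambda>s. Gw (?d - s))"
      have h: "geodesic_path h (f y) (f x)"
        using G(3) unfolding geodesic_path_def isometric_on_def h_def
        by (auto simp: dist_commute dist_real_def)
      have "?d - gp (f y) (f x) (f w) = gp (f x) (f w) (f y)"
        using gp_swap[of "f x" "f y" "f w"] gp_commute[of "f x" "f w" "f y"] by linarith
      then have "h (gp (f y) (f x) (f w)) = m" by (simp add: h_def m_def)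
      then show ?thesis
        using geodesics_fellow_travel[OF h G(2) gp_nonneg order_refl] by (simp add: ny_def)
    qed
    obtain p where p: "dist x p + dist p y = dist x y" "dist m (f p) \<le> H"
      using H[OF G(3) gp_nonneg gp_le_dist(2)] unfolding m_def by blast
    obtain px where px: "dist x px + dist px w = dist x w" "dist nx (f px) \<le> H"
      using H[OF G(1) gp_nonneg gp_le_dist(1)] unfolding nx_def by blast
    obtain py where py: "dist y py + dist py w = dist y w" "dist ny (f py) \<le> H"
      using H[OF G(2) gp_nonneg gp_le_dist(2)] unfolding ny_def by blast
    have "dist (f p) (f px) \<le> 2 * H + 4 * \<delta>"
      using dist_triangle[of "f p" "f px" m] dist_triangle[of m "f px" nx] p(2) px(2) m_nx
      by (simp add: dist_commute)
    then have "K * (dist (f p) (f px) + C) \<le> R" unfolding R_def using K by (intro mult_left_mono) auto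
    then have dpx: "dist p px \<le> R" using quasi_isometric_embeddingD(4)[OF f, of p px] by linarith
    have "dist (f p) (f py) \<le> 2 * H + 4 * \<delta>"
      using dist_triangle[of "f p" "f py" m] dist_triangle[of m "f py" ny] p(2) py(2) m_ny
      by (simp add: dist_commute)
    then have "K * (dist (f p) (f py) + C) \<le> R" unfolding R_def using K by (intro mult_left_mono) auto
    then have dpy: "dist p py \<le> R" using quasi_isometric_embeddingD(4)[OF f, of p py] by linarith
    have "dist w p \<le> gp w x y + 2 * R"
      using dpx dpy p(1) px(1) py(1) dist_triangle[of x p px] dist_triangle[of p w px]
        dist_triangle[of y p py] dist_triangle[of p w py]
      by (simp add: gromov_product_def dist_commute field_simps)
    then have "K * dist w p \<le> K * (gp w x y + 2 * R)" using K by (intro mult_left_mono) auto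
    then have "dist (f w) m \<le> K * (gp w x y + 2 * R) + C + H"
      using quasi_isometric_embeddingD(3)[OF f, of w p] dist_triangle[of "f w" m "f p"] p(2)
      by (simp add: dist_commute)
    moreover have "dist (f x) m + dist m (f y) = dist (f x) (f y)"
      using geodesic_path_dist_ends[OF G(3) gp_nonneg gp_le_dist(2)] by (simp add: m_def)
    then have "gp (f w) (f x) (f y) \<le> dist (f w) m" by (rule gp_le_dist_between)
    ultimately show ?thesis by (simp add: algebra_simps)
  qed
  then show thesis using that by blast
qed

lemma quasi_isometric_embedding_gromov_sequence:
  fixes f :: "'a \<Rightarrow> 'a"
  assumes f: "quasi_isometric_embedding K C f" and u: "gromov_sequence u"
  shows "gromov_sequence (f \<circ> u)"
  unfolding gromov_sequence_iff[of _ "f undefined"]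
proof
  fix M
  obtain B where B: "\<And>w x y. gp w x y \<le> K * (gp (f w) (f x) (f y) + B)"
    using quasi_isometric_embedding_gp_lower[OF f] by blast
  have K: "1 \<le> K" by (rule quasi_isometric_embeddingD[OF f])
  obtain N where N: "\<And>i j. N \<le> i \<Longrightarrow> N \<le> j \<Longrightarrow> K * (M + B) \<le> gp undefined (u i) (u j)"
    using gromov_sequenceD[OF u] by blast
  have "M \<le> gp (f undefined) ((f \<circ> u) i) ((f \<circ> u) j)" if "N \<le> i" "N \<le> j" for i j
  proof -
    have "K * (M + B) \<le> K * (gp (f undefined) (f (u i)) (f (u j)) + B)"
      using N[OF that] B by (rule order_trans)
    then show ?thesis using K by (simp add: mult_le_cancel_left)
  qed
  then show "\<exists>N. \<forall>i\<ge>N. \<forall>j\<ge>N. M \<le> gp (f undefined) ((f \<circ> u) i) ((f \<circ> u) j)" by blast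
qed

lemma boundary_map_id_gromov_rel:
  fixes f :: "'a \<Rightarrow> 'a"
  assumes f: "quasi_isometric_embedding K C f" and id: "\<forall>\<xi>\<in>gromov_boundary. boundary_map f \<xi> = \<xi>"
    and u: "gromov_sequence u"
  shows "(u, f \<circ> u) \<in> gromov_rel"
proof -
  let ?\<xi> = "gromov_rel `` {u}"
  have u': "u \<in> ?\<xi>" using gromov_sequence_refl[OF u] by simp
  have "f \<circ> u \<in> boundary_map f ?\<xi>"
    using gromov_sequence_refl[OF quasi_isometric_embedding_gromov_sequence[OF f u]] u'
    unfolding boundary_map_def by blast
  then show ?thesis using id gromov_class_in_boundary[OF u] by simp
qed

text \<open>A quasi-isometry that fixes the boundary maps a centre of a triple of boundary points
  to a centre of the same triple.\<close>

lemma coarse_centres_imp_boundary_rigid: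
  assumes C: "\<And>x::'a. coarse_centre C x"
  shows "boundary_rigid TYPE('a)"
  unfolding boundary_rigid_def
proof (intro allI impI, elim conjE)
  fix f :: "'a \<Rightarrow> 'a"
  assume "quasi_isometry f" and id: "\<forall>\<xi>\<in>gromov_boundary. boundary_map f \<xi> = \<xi>"
  then obtain K c where f: "quasi_isometric_embedding K c f" unfolding quasi_isometry_def by blast
  obtain B where B: "\<And>w x y. gp (f w) (f x) (f y) \<le> K * gp w x y + B"
    using quasi_isometric_embedding_gp_upper[OF f] by blast
  have K: "1 \<le> K" by (rule quasi_isometric_embeddingD[OF f])
  define E where "E = max C (K * C + B + 2 * \<delta>)"
  have "dist x (f x) \<le> 2 * (E + \<delta>)" for x
  proof -
    obtain u v z where gs: "gromov_sequence u" "gromov_sequence v" "gromov_sequence z"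
      and ctr: "\<forall>\<^sub>F n in sequentially. gp x (u n) (v n) \<le> C \<and> gp x (v n) (z n) \<le> C \<and> gp x (u n) (z n) \<le> C"
      using C[of x] unfolding coarse_centre_def by blast
    have large: "\<forall>\<^sub>F n in sequentially. K * C + B + 2 * \<delta> + 1 \<le> gp (f x) (a n) (f (a n))"
      if "gromov_sequence a" for a
      using gromov_relD[OF boundary_map_id_gromov_rel[OF f id that]] by simp
    have image: "gp (f x) a b \<le> E"
      if "gp x a b \<le> C" "K * C + B + 2 * \<delta> + 1 \<le> gp (f x) a (f a)"
        "K * C + B + 2 * \<delta> + 1 \<le> gp (f x) b (f b)" for a b
    proof -
      have "K * gp x a b \<le> K * C" using that(1) K by (intro mult_left_mono) auto
      then have "gp (f x) (f a) (f b) \<le> K * C + B" using B[of x a b] by linarith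
      then show ?thesis
        using six_point[of "f x" "f a" a b "f b"] that(2,3) delta_nonneg
        by (simp add: E_def gp_commute[of "f x" "f a" a])
    qed
    have "\<forall>\<^sub>F n in sequentially. dist x (f x) \<le> 2 * (E + \<delta>)"
      using ctr large[OF gs(1)] large[OF gs(2)] large[OF gs(3)]
    proof eventually_elim
      case (elim n)
      have "gp x (u n) (v n) \<le> E" "gp x (v n) (z n) \<le> E" "gp x (u n) (z n) \<le> E"
        using elim(1) by (auto simp: E_def)
      then show ?case by (rule dist_centres_le) (use image elim in blast)+
    qed
    then show ?thesis by simp
  qed
  then show "bdd_above (range (\<lambda>x. dist x (f x)))" by (intro bdd_aboveI2)
qed

end

section \<open>Long tubes where branching fails\<close>

text \<open>Close to the part of \<open>\<sigma>\<close> at heights between \<open>a\<close> and \<open>b\<close> the space looks like a line: points at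
  distance at most \<open>D\<close> cannot be continued to points at distance between \<open>D\<close> and \<open>D + 2\<close>.
  The margin \<open>c\<close> allows for geodesics that leave \<open>\<sigma>\<close> just below the height \<open>a\<close>.\<close>

definition tube :: "'a::metric_space \<Rightarrow> real \<Rightarrow> real \<Rightarrow> real \<Rightarrow> real \<Rightarrow> (real \<Rightarrow> 'a) \<Rightarrow> bool" where
  "tube w D c a b \<sigma> \<longleftrightarrow> 0 \<le> a \<and> a \<le> b \<and> isometric_on {0..b} \<sigma> \<and> \<sigma> 0 = w \<and>
     (\<forall>y. a + c \<le> dist w y \<longrightarrow> dist w y \<le> b \<longrightarrow> dist y (\<sigma> (dist w y)) \<le> D + 2 \<longrightarrow>
        dist y (\<sigma> (dist w y)) \<le> D)"

text \<open>A range of heights at which nothing separates from \<open>u\<close>.  The alternative can be required for all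
  large \<open>n\<close> at once because products along Gromov sequences settle up to \<open>2\<delta>\<close>.\<close>

definition branching_gap :: "'a::metric_space \<Rightarrow> (nat \<Rightarrow> 'a) \<Rightarrow> real \<Rightarrow> real \<Rightarrow> bool" where
  "branching_gap w u a b \<longleftrightarrow>
     (\<forall>v. gromov_sequence v \<longrightarrow> (\<forall>\<^sub>F n in sequentially. gp w (u n) (v n) < a) \<or>
                              (\<forall>\<^sub>F n in sequentially. b < gp w (u n) (v n)))"

lemma branching_gap_mono:
  assumes "branching_gap w u a b" "a \<le> a'" "b' \<le> b"
  shows "branching_gap w u a' b'"
  unfolding branching_gap_def
proof (intro allI impI)
  fix v :: "nat \<Rightarrow> 'a"
  assume "gromov_sequence v"
  then consider "\<forall>\<^sub>F n in sequentially. gp w (u n) (v n) < a"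
    | "\<forall>\<^sub>F n in sequentially. b < gp w (u n) (v n)"
    using assms(1) unfolding branching_gap_def by blast
  then show "(\<forall>\<^sub>F n in sequentially. gp w (u n) (v n) < a') \<or>
      (\<forall>\<^sub>F n in sequentially. b' < gp w (u n) (v n))"
  proof cases
    case 1
    then have "\<forall>\<^sub>F n in sequentially. gp w (u n) (v n) < a'"
      by eventually_elim (use assms(2) in linarith)
    then show ?thesis ..
  next
    case 2
    then have "\<forall>\<^sub>F n in sequentially. b' < gp w (u n) (v n)"
      by eventually_elim (use assms(3) in linarith)
    then show ?thesis ..
  qed
qed

context hyperbolic_geodesic begin

lemma not_branching_imp_gap:
  fixes w :: 'a
  assumes nb: "\<not> (\<exists>A. branching w A)" and l: "0 \<le> l"
  obtains u a where "gromov_sequence u" "0 \<le> a" "branching_gap w u a (a + l)"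
proof -
  obtain u t where u: "gromov_sequence u" and t: "0 \<le> t"
    and no: "\<And>v. gromov_sequence v \<Longrightarrow>
        \<not> (\<forall>\<^sub>F n in sequentially. \<bar>gp w (u n) (v n) - t\<bar> \<le> l + 2 * \<delta>)"
    using nb unfolding branching_def by blast
  have "branching_gap w u t (t + l)"
    unfolding branching_gap_def
  proof (intro allI impI)
    fix v :: "nat \<Rightarrow> 'a"
    assume v: "gromov_sequence v"
    note refl = gromov_sequence_refl[OF u] gromov_sequence_refl[OF v]
    have "\<exists>\<^sub>F n in sequentially. gp w (u n) (v n) < t - l - 2 * \<delta> \<or> t + l + 2 * \<delta> < gp w (u n) (v n)"
      using no[OF v] unfolding not_eventually by (rule frequently_elim1) linarith
    then consider "\<exists>\<^sub>F n in sequentially. gp w (u n) (v n) < t - l - 2 * \<delta>"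
      | "\<exists>\<^sub>F n in sequentially. t + l + 2 * \<delta> < gp w (u n) (v n)"
      unfolding frequently_disj_iff by blast
    then show "(\<forall>\<^sub>F n in sequentially. gp w (u n) (v n) < t) \<or>
        (\<forall>\<^sub>F n in sequentially. t + l < gp w (u n) (v n))"
    proof cases
      case 1
      have "\<forall>\<^sub>F n in sequentially. gp w (u n) (v n) < t"
        using gp_frequently_less_imp_eventually[OF refl 1] by eventually_elim (use l in linarith)
      then show ?thesis ..
    next
      case 2
      have "\<forall>\<^sub>F n in sequentially. t + l < gp w (u n) (v n)"
        using gp_frequently_greater_imp_eventually[OF refl 2] by eventually_elim linarith
      then show ?thesis ..
    qed
  qed
  then show thesis using that u t by blast
qed

text \<open>A point \<open>y\<close> near \<open>\<sigma>\<close> lies in front of some boundary point, which is not separated from \<open>u\<close>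
  below \<open>a\<close>, hence not below \<open>b\<close> either; so \<open>y\<close> is near \<open>\<sigma>\<close> with a constant that
  depends only on \<open>\<delta>\<close> and the visibility constant.\<close>

lemma branching_gap_imp_tube:
  fixes w :: 'a
  assumes vis: "visible_from w L" and L: "0 \<le> L" and u: "gromov_sequence u"
    and gap: "branching_gap w u a b" and ab: "0 \<le> a" "a \<le> b"
    and D: "D = 2 * L + 6 * \<delta>" and c: "c = D + 2 + L + 3 * \<delta>"
  obtains \<sigma> where "tube w D c a b \<sigma>"
proof -
  obtain N where N: "\<And>i j. N \<le> i \<Longrightarrow> N \<le> j \<Longrightarrow> b \<le> gp w (u i) (u j)"
    using gromov_sequenceD[OF u] by blast
  have far: "b \<le> dist w (u N)" using N[of N N] by simp
  obtain \<sigma> where \<sigma>: "geodesic_path \<sigma> w (u N)" using geodesic_between .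
  have iso: "isometric_on {0..b} \<sigma>" "\<sigma> 0 = w"
    using \<sigma> far by (auto simp: geodesic_path_def isometric_on_def)
  have "dist y (\<sigma> (dist w y)) \<le> D"
    if y: "a + c \<le> dist w y" "dist w y \<le> b" "dist y (\<sigma> (dist w y)) \<le> D + 2" for y
  proof -
    define s p where "s = dist w y" and "p = \<sigma> s"
    have s: "0 \<le> s" "s \<le> b" "a + c \<le> s" using y by (auto simp: s_def)
    have wp: "dist w p = s" and pu: "dist p (u N) = dist w (u N) - s"
      using geodesic_path_dist_ends[OF \<sigma>, of s] s far by (auto simp: p_def)
    have yp: "gp w y p = s - dist y p / 2"
      using wp by (simp add: gromov_product_def s_def dist_commute field_simps)
    have "gp w p (u N) = s" using wp pu by (simp add: gromov_product_def dist_commute)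
    then have pu': "s - \<delta> \<le> gp w p (u n)" if "N \<le> n" for n
      using four_point[of w p "u N" "u n"] N[of N n] that s by simp
    obtain v where v: "gromov_sequence v" "\<forall>\<^sub>F n in sequentially. s - L \<le> gp w y (v n)"
      using vis unfolding visible_from_def s_def by blast
    have "dist y p \<le> D + 2" using y(3) by (simp add: p_def s_def)
    then have low: "s - D / 2 - 1 \<le> gp w y p" using yp by (simp add: field_simps)
    have ge_a: "\<forall>\<^sub>F n in sequentially. a \<le> gp w (u n) (v n)"
      using v(2) eventually_ge_at_top[of N]
    proof eventually_elim
      case (elim n)
      show ?case
        using six_point[of w "u n" p y "v n"] pu'[OF elim(2)] low elim(1) s L delta_nonneg D
        unfolding c gp_commute[of w "u n" p] gp_commute[of w p y] by linarith
    qed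
    have "\<not> (\<forall>\<^sub>F n in sequentially. gp w (u n) (v n) < a)"
    proof
      assume "\<forall>\<^sub>F n in sequentially. gp w (u n) (v n) < a"
      then have "\<forall>\<^sub>F n in sequentially. False" using ge_a by eventually_elim simp
      then show False by simp
    qed
    then have above: "\<forall>\<^sub>F n in sequentially. b < gp w (u n) (v n)"
      using gap v(1) unfolding branching_gap_def by blast
    have "\<forall>\<^sub>F n in sequentially. s - L - 3 * \<delta> \<le> gp w y p"
      using v(2) above eventually_ge_at_top[of N]
    proof eventually_elim
      case (elim n)
      show ?case
        using six_point[of w y "v n" "u n" p] pu'[OF elim(3)] elim(1,2) s L delta_nonneg
        unfolding gp_commute[of w "u n" p] gp_commute[of w "v n" "u n"] by linarith
    qed
    then have "s - L - 3 * \<delta> \<le> gp w y p" by simp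
    then show ?thesis using yp unfolding D p_def s_def by linarith
  qed
  then have "tube w D c a b \<sigma>" unfolding tube_def using ab iso by blast
  then show thesis using that by blast
qed

text \<open>A gap of length \<open>r + k\<close> contains one of length \<open>k\<close> above height \<open>r\<close>, so tubes of
  increasing length can be stacked in disjoint spherical shells around \<open>w\<close>.\<close>

lemma not_branching_imp_disjoint_tubes:
  fixes w :: 'a
  assumes vis: "visible_from w L" and nb: "\<not> (\<exists>A. branching w A)"
  obtains D c a b \<sigma> where "0 \<le> D" "0 \<le> c" "\<And>n::nat. tube w D c (a n) (b n) (\<sigma> n)"
    "\<And>n. real n \<le> b n - a n" "\<And>n. b n + 2 \<le> a (Suc n)"
proof -
  define L' where "L' = \<bar>L\<bar>"
  have vis': "visible_from w L'" unfolding visible_from_def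
  proof
    fix x :: 'a
    obtain u where u: "gromov_sequence u" "\<forall>\<^sub>F n in sequentially. dist w x - L \<le> gp w x (u n)"
      using vis unfolding visible_from_def by blast
    have "\<forall>\<^sub>F n in sequentially. dist w x - L' \<le> gp w x (u n)"
      using u(2) by eventually_elim (simp add: L'_def)
    then show "\<exists>u. gromov_sequence u \<and> (\<forall>\<^sub>F n in sequentially. dist w x - L' \<le> gp w x (u n))"
      using u(1) by blast
  qed
  have L': "0 \<le> L'" by (simp add: L'_def)
  define D where "D = 2 * L' + 6 * \<delta>"
  define c where "c = D + 2 + L' + 3 * \<delta>"
  have next_tube: "\<exists>a b \<sigma>. tube w D c a b \<sigma> \<and> r \<le> a \<and> k \<le> b - a" if "0 \<le> r" "0 \<le> k" for r k
  proof -
    obtain u a where u: "gromov_sequence u" "0 \<le> a" "branching_gap w u a (a + (r + k))"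
      using not_branching_imp_gap[OF nb, of "r + k"] \<open>0 \<le> r\<close> \<open>0 \<le> k\<close> by auto
    have gap: "branching_gap w u (max a r) (a + (r + k))"
      by (rule branching_gap_mono[OF u(3)]) auto
    have ab: "0 \<le> max a r" "max a r \<le> a + (r + k)" "k \<le> a + (r + k) - max a r"
      using u(2) \<open>0 \<le> r\<close> \<open>0 \<le> k\<close> by auto
    obtain \<sigma> where "tube w D c (max a r) (a + (r + k)) \<sigma>"
      using branching_gap_imp_tube[OF vis' L' u(1) gap ab(1,2) D_def c_def] .
    then show ?thesis using ab(3) by (meson max.cobounded2)
  qed
  define P where "P = (\<lambda>n (a, b, \<sigma>). tube w D c a b \<sigma> \<and> real n \<le> b - a)"
  define Q where "Q = (\<lambda>(n::nat) (x :: real \<times> real \<times> (real \<Rightarrow> 'a)) (y :: real \<times> real \<times> (real \<Rightarrow> 'a)).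
    fst (snd x) + 2 \<le> fst y)"
  obtain T where T: "\<And>n. P n (T n)" "\<And>n. Q n (T n) (T (Suc n))"
  proof -
    have "\<exists>T. \<forall>n. P n (T n) \<and> Q n (T n) (T (Suc n))"
    proof (rule dependent_nat_choice)
      show "\<exists>x. P 0 x" using next_tube[of 0 0] by (auto simp: P_def)
      fix x n
      assume "P n x"
      obtain a b \<sigma> where x: "x = (a, b, \<sigma>)" by (cases x)
      then have "0 \<le> b + 2" using \<open>P n x\<close> by (auto simp: P_def tube_def)
      then obtain a' b' \<sigma>' where "tube w D c a' b' \<sigma>'" "b + 2 \<le> a'" "real (Suc n) \<le> b' - a'"
        using next_tube[of "b + 2" "real (Suc n)"] by auto
      then have "P (Suc n) (a', b', \<sigma>') \<and> Q n x (a', b', \<sigma>')" unfolding x P_def Q_def by simp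
      then show "\<exists>y. P (Suc n) y \<and> Q n x y" by blast
    qed
    then show ?thesis using that by blast
  qed
  show thesis
  proof (rule that)
    show "0 \<le> D" "0 \<le> c" using L' delta_nonneg by (auto simp: D_def c_def)
    fix n
    show "tube w D c (fst (T n)) (fst (snd (T n))) (snd (snd (T n)))"
      "real n \<le> fst (snd (T n)) - fst (T n)"
      using T(1)[of n] by (auto simp: P_def split: prod.splits)
    show "fst (snd (T n)) + 2 \<le> fst (T (Suc n))"
      using T(2)[of n] by (auto simp: Q_def split: prod.splits)
  qed
qed

end

section \<open>Shifting along tubes\<close>

locale disjoint_tubes = hyperbolic_geodesic X \<delta> for X :: "'a::metric_space itself" and \<delta> +
  fixes w :: 'a and D c :: real and a b :: "nat \<Rightarrow> real" and \<sigma> :: "nat \<Rightarrow> real \<Rightarrow> 'a"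
  assumes constants: "0 \<le> D" "0 \<le> c"
    and tube: "tube w D c (a n) (b n) (\<sigma> n)"
    and separated_Suc: "b n + 2 \<le> a (Suc n)"
begin

definition in_tube :: "nat \<Rightarrow> 'a \<Rightarrow> bool" where
  "in_tube n x \<longleftrightarrow> a n \<le> dist w x \<and> dist w x \<le> b n \<and> dist x (\<sigma> n (dist w x)) \<le> D"

text \<open>The map along the tubes forgets the distance from \<open>\<sigma>\<close>, which is bounded anyway; at most one
  tube contains \<open>x\<close>.\<close>

definition shift :: "(nat \<Rightarrow> real \<Rightarrow> real) \<Rightarrow> 'a \<Rightarrow> 'a" where
  "shift \<phi> x = (if \<exists>n. in_tube n x
     then let n = (SOME n. in_tube n x) in \<sigma> n (\<phi> n (dist w x)) else x)"

text \<open>The Lipschitz constant \<open>2\<close> is the larger slope of the piecewise linear maps in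
  \<open>long_tubes_imp_not_boundary_rigid\<close> and of their inverses.\<close>

definition reparametrisation :: "(nat \<Rightarrow> real \<Rightarrow> real) \<Rightarrow> bool" where
  "reparametrisation \<phi> \<longleftrightarrow>
     (\<forall>n. \<phi> n (a n) = a n \<and> \<phi> n (b n) = b n \<and> \<phi> n ` {a n..b n} \<subseteq> {a n..b n} \<and>
        (\<forall>s\<in>{a n..b n}. \<forall>t\<in>{a n..b n}. \<bar>\<phi> n s - \<phi> n t\<bar> \<le> 2 * \<bar>s - t\<bar>))"

lemma tube_bounds: "0 \<le> a n" "a n \<le> b n"
  using tube[of n] by (auto simp: tube_def)

lemma tube_dist:
  assumes "s \<in> {a n..b n}" "t \<in> {a n..b n}"
  shows "dist (\<sigma> n s) (\<sigma> n t) = \<bar>s - t\<bar>"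
  using tube[of n] tube_bounds[of n] assms
  by (auto simp: tube_def intro!: isometric_on_dist)

lemma tube_height: "s \<in> {a n..b n} \<Longrightarrow> dist w (\<sigma> n s) = s"
proof -
  assume s: "s \<in> {a n..b n}"
  have "dist (\<sigma> n 0) (\<sigma> n s) = \<bar>0 - s\<bar>"
    using tube[of n] tube_bounds[of n] s by (intro isometric_on_dist) (auto simp: tube_def)
  then show ?thesis using tube[of n] tube_bounds[of n] s by (simp add: tube_def)
qed

lemma in_tube_centre: "s \<in> {a n..b n} \<Longrightarrow> in_tube n (\<sigma> n s)"
  using tube_height[of s n] constants by (simp add: in_tube_def)

lemma separated: "m < n \<Longrightarrow> b m + 2 \<le> a n"
proof (induction n)
  case (Suc n)
  then show ?case using separated_Suc[of n] separated_Suc[of m] tube_bounds[of n]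
    by (cases "m = n") auto
qed simp

lemma in_tube_close_unique:
  assumes "in_tube m x" "in_tube n y" "dist x y \<le> 1"
  shows "m = n"
proof -
  have "\<bar>dist w x - dist w y\<bar> \<le> 1"
    using assms(3) dist_triangle[of w x y] dist_triangle[of w y x] by (simp add: dist_commute)
  then show ?thesis
    using separated[of m n] separated[of n m] assms(1,2) unfolding in_tube_def
    by (cases m n rule: linorder_cases) auto
qed

lemma shift_in_tube:
  assumes "in_tube n x"
  shows "shift \<phi> x = \<sigma> n (\<phi> n (dist w x))"
proof -
  have "in_tube (SOME n. in_tube n x) x" using assms by (rule someI)
  then have "(SOME n. in_tube n x) = n" using in_tube_close_unique assms by fastforce
  then show ?thesis using assms by (auto simp: shift_def Let_def)
qed

lemma shift_outside: "(\<And>n. \<not> in_tube n x) \<Longrightarrow> shift \<phi> x = x"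
  by (simp add: shift_def)

lemma shift_stays:
  assumes "reparametrisation \<phi>" "in_tube n x"
  shows "in_tube n (shift \<phi> x)" "dist w (shift \<phi> x) = \<phi> n (dist w x)"
proof -
  have "\<phi> n (dist w x) \<in> {a n..b n}"
    using assms unfolding reparametrisation_def in_tube_def by (auto simp: image_subset_iff)
  then show "in_tube n (shift \<phi> x)" "dist w (shift \<phi> x) = \<phi> n (dist w x)"
    using in_tube_centre tube_height shift_in_tube[OF assms(2)] by auto
qed

text \<open>A point of a tube with a neighbour outside can only be near one of the ends of the tube, where
  a reparametrisation that fixes the ends moves points by a bounded amount.\<close>

lemma dist_shift_leaving_tube:
  assumes \<phi>: "reparametrisation \<phi>" and x: "in_tube n x" and xy: "dist x y \<le> 1"
    and y: "\<not> in_tube n y"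
  shows "dist (shift \<phi> x) x \<le> D + 3 * (c + 1)"
proof -
  let ?s = "dist w x"
  have s: "?s \<in> {a n..b n}" "a n \<in> {a n..b n}" "b n \<in> {a n..b n}"
    using x tube_bounds[of n] by (auto simp: in_tube_def)
  have st: "\<bar>dist w y - ?s\<bar> \<le> 1"
    using xy dist_triangle[of w x y] dist_triangle[of w y x] by (simp add: dist_commute)
  have "?s - a n \<le> c + 1 \<or> b n - ?s \<le> c + 1"
  proof (rule ccontr)
    assume "\<not> ?thesis"
    then have t: "a n + c \<le> dist w y" "dist w y \<le> b n" using st constants by linarith+
    then have "dist w y \<in> {a n..b n}" using constants by auto
    then have "dist (\<sigma> n ?s) (\<sigma> n (dist w y)) \<le> 1" using tube_dist s st by auto
    then have "dist y (\<sigma> n (dist w y)) \<le> D + 2"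
      using x xy dist_triangle[of y "\<sigma> n (dist w y)" x]
        dist_triangle[of x "\<sigma> n (dist w y)" "\<sigma> n ?s"]
      by (simp add: in_tube_def dist_commute)
    then have "dist y (\<sigma> n (dist w y)) \<le> D" using tube[of n] t unfolding tube_def by blast
    then show False using y t constants unfolding in_tube_def by linarith
  qed
  moreover have "\<bar>\<phi> n ?s - ?s\<bar> \<le> 3 * (?s - a n)" "\<bar>\<phi> n ?s - ?s\<bar> \<le> 3 * (b n - ?s)"
  proof -
    have "\<bar>\<phi> n ?s - \<phi> n (a n)\<bar> \<le> 2 * \<bar>?s - a n\<bar>" "\<bar>\<phi> n ?s - \<phi> n (b n)\<bar> \<le> 2 * \<bar>?s - b n\<bar>"
      "\<phi> n (a n) = a n" "\<phi> n (b n) = b n"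
      using \<phi> s unfolding reparametrisation_def by blast+
    then show "\<bar>\<phi> n ?s - ?s\<bar> \<le> 3 * (?s - a n)" "\<bar>\<phi> n ?s - ?s\<bar> \<le> 3 * (b n - ?s)"
      using s by auto
  qed
  moreover have "dist (shift \<phi> x) x \<le> \<bar>\<phi> n ?s - ?s\<bar> + D"
  proof -
    have "\<phi> n ?s \<in> {a n..b n}"
      using \<phi> s unfolding reparametrisation_def by (auto simp: image_subset_iff)
    then have "dist (shift \<phi> x) (\<sigma> n ?s) = \<bar>\<phi> n ?s - ?s\<bar>"
      using tube_dist s shift_in_tube[OF x] by simp
    then show ?thesis using x dist_triangle[of "shift \<phi> x" x "\<sigma> n ?s"]
      by (simp add: in_tube_def dist_commute)
  qed
  ultimately show ?thesis by (elim disjE) (simp_all add: algebra_simps)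
qed

lemma shift_local:
  assumes \<phi>: "reparametrisation \<phi>" and xy: "dist x y \<le> 1"
  shows "dist (shift \<phi> x) (shift \<phi> y) \<le> D + 3 * (c + 1) + 1"
proof -
  have mixed: "dist (shift \<phi> x) (shift \<phi> y) \<le> D + 3 * (c + 1) + 1"
    if "in_tube n x" "dist x y \<le> 1" "\<And>m. \<not> in_tube m y" for n x y
    using dist_shift_leaving_tube[OF \<phi> that(1,2) that(3)] shift_outside[of y \<phi>, OF that(3)] that(2)
      dist_triangle[of "shift \<phi> x" y x] by simp
  consider n where "in_tube n x" "in_tube n y" | n where "in_tube n x" "\<And>m. \<not> in_tube m y"
    | n where "in_tube n y" "\<And>m. \<not> in_tube m x" | "\<And>m. \<not> in_tube m x" "\<And>m. \<not> in_tube m y"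
    using in_tube_close_unique[OF _ _ xy] by blast
  then show ?thesis
  proof cases
    case (1 n)
    then have s: "dist w x \<in> {a n..b n}" "dist w y \<in> {a n..b n}" by (auto simp: in_tube_def)
    then have "\<phi> n (dist w x) \<in> {a n..b n}" "\<phi> n (dist w y) \<in> {a n..b n}"
      "\<bar>\<phi> n (dist w x) - \<phi> n (dist w y)\<bar> \<le> 2 * \<bar>dist w x - dist w y\<bar>"
      using \<phi> unfolding reparametrisation_def by (auto simp: image_subset_iff)
    then have "dist (shift \<phi> x) (shift \<phi> y) \<le> 2 * \<bar>dist w x - dist w y\<bar>"
      using tube_dist shift_in_tube[OF 1(1)] shift_in_tube[OF 1(2)] by simp
    moreover have "\<bar>dist w x - dist w y\<bar> \<le> 1"
      using xy dist_triangle[of w x y] dist_triangle[of w y x] by (simp add: dist_commute)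
    ultimately show ?thesis using constants by simp
  next
    case (2 n)
    then show ?thesis using mixed xy by blast
  next
    case (3 n)
    then show ?thesis using mixed[of n y x] xy by (simp add: dist_commute)
  next
    case 4
    then show ?thesis using shift_outside xy constants by simp
  qed
qed

lemma shift_inverse:
  assumes \<phi>: "reparametrisation \<phi>" and inv: "\<And>n s. s \<in> {a n..b n} \<Longrightarrow> \<psi> n (\<phi> n s) = s"
  shows "dist (shift \<psi> (shift \<phi> x)) x \<le> D"
proof (cases "\<exists>n. in_tube n x")
  case True
  then obtain n where n: "in_tube n x" ..
  have "shift \<psi> (shift \<phi> x) = \<sigma> n (\<psi> n (\<phi> n (dist w x)))"
    using shift_in_tube[OF shift_stays(1)[OF \<phi> n]] shift_stays(2)[OF \<phi> n] by simp
  also have "\<dots> = \<sigma> n (dist w x)" using inv n by (simp add: in_tube_def)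
  finally show ?thesis using n by (simp add: in_tube_def dist_commute)
next
  case False
  then show ?thesis using shift_outside constants by simp
qed

end

context hyperbolic_geodesic begin

lemma coarse_lipschitz:
  fixes f :: "'a \<Rightarrow> 'a"
  assumes loc: "\<And>x y. dist x y \<le> 1 \<Longrightarrow> dist (f x) (f y) \<le> E" and E: "0 \<le> E"
  shows "dist (f x) (f y) \<le> E * dist x y + E"
proof -
  have chain: "dist (f x) (f y) \<le> E * real n" if "dist x y \<le> real n" "0 < n" for n x y
    using that(2,1)
  proof (induction n arbitrary: x rule: nat_induct_non_zero)
    case 1
    then show ?case using loc[of x y] by simp
  next
    case (Suc n)
    show ?case
    proof (cases "dist x y \<le> 1")
      case True
      have "E * 1 \<le> E * real (Suc n)" using E by (intro mult_left_mono) auto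
      then show ?thesis using loc[OF True] by simp
    next
      case False
      obtain g where g: "geodesic_path g x y" using geodesic_between .
      have d: "dist x (g 1) = 1" "dist (g 1) y = dist x y - 1"
        using geodesic_path_dist_ends[OF g, of 1] False by auto
      then have "dist (f (g 1)) (f y) \<le> E * real n" using Suc by simp
      then show ?thesis
        using loc[of x "g 1"] d(1) dist_triangle[of "f x" "f y" "f (g 1)"] by (simp add: algebra_simps)
    qed
  qed
  define n where "n = Suc (nat \<lfloor>dist x y\<rfloor>)"
  have n: "dist x y \<le> real n" "real n \<le> dist x y + 1" "0 < n"
    using zero_le_dist[of x y] by (auto simp: n_def) linarith+
  have "E * real n \<le> E * (dist x y + 1)" using n(2) E by (intro mult_left_mono)
  then show ?thesis using chain[OF n(1,3)] by (simp add: algebra_simps)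
qed

text \<open>The lower bound for \<open>f\<close> is the Lipschitz bound for its coarse inverse \<open>g\<close>, so that both
  bounds only have to be checked on pairs of points at distance at most \<open>1\<close>.\<close>

lemma quasi_isometryI:
  fixes f g :: "'a \<Rightarrow> 'a"
  assumes f: "\<And>x y. dist x y \<le> 1 \<Longrightarrow> dist (f x) (f y) \<le> E"
    and g: "\<And>x y. dist x y \<le> 1 \<Longrightarrow> dist (g x) (g y) \<le> E"
    and gf: "\<And>x. dist (g (f x)) x \<le> D" and fg: "\<And>x. dist (f (g x)) x \<le> D" and E: "1 \<le> E"
  shows "quasi_isometry f"
proof -
  have D: "0 \<le> D" using gf[of undefined] zero_le_dist order_trans by blast
  have "inverse E * dist x y - (E + 2 * D) \<le> dist (f x) (f y)" for x y
  proof -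
    have "dist x y \<le> dist (g (f x)) (g (f y)) + 2 * D"
      using gf[of x] gf[of y] dist_triangle[of x y "g (f x)"] dist_triangle[of "g (f x)" y "g (f y)"]
      by (simp add: dist_commute)
    also have "\<dots> \<le> (E * dist (f x) (f y) + E) + 2 * D"
      using coarse_lipschitz[of g E "f x" "f y"] g E by simp
    also have "\<dots> \<le> E * (dist (f x) (f y) + (E + 2 * D))"
      using mult_right_mono[of 1 E "E + 2 * D"] E D by (simp add: algebra_simps)
    finally show ?thesis using E by (simp add: field_simps)
  qed
  moreover have "dist (f x) (f y) \<le> E * dist x y + (E + 2 * D)" for x y
    using coarse_lipschitz[of f E x y] f E D by simp
  ultimately have "quasi_isometric_embedding E (E + 2 * D) f"
    using E D unfolding quasi_isometric_embedding_def by auto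
  moreover have "\<exists>x. dist y (f x) \<le> E + 2 * D" for y
    using fg[of y] E D by (intro exI[of _ "g y"]) (simp add: dist_commute)
  ultimately show ?thesis unfolding quasi_isometry_def by blast
qed

lemma boundary_map_idI:
  fixes f :: "'a \<Rightarrow> 'a"
  assumes rel: "\<And>u. gromov_sequence u \<Longrightarrow> (u, f \<circ> u) \<in> gromov_rel" and \<xi>: "\<xi> \<in> gromov_boundary"
  shows "boundary_map f \<xi> = \<xi>"
proof
  have gs: "gromov_sequence u" if "u \<in> \<xi>" for u
    using boundary_points_related[OF \<xi> that that] by (simp add: gromov_rel_def)
  show "boundary_map f \<xi> \<subseteq> \<xi>"
    unfolding boundary_map_def using boundary_point_closed[OF \<xi>] rel gs by blast
  show "\<xi> \<subseteq> boundary_map f \<xi>"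
  proof
    fix u
    assume u: "u \<in> \<xi>"
    have "(f \<circ> u, u) \<in> gromov_rel"
      using rel[OF gs[OF u]] gromov_rel_equiv by (meson equivE symD)
    then show "u \<in> boundary_map f \<xi>" unfolding boundary_map_def using u by blast
  qed
qed

end

context disjoint_tubes begin

text \<open>Stretching the first third of each tube over the first two thirds moves the point
  at one third of the tube by a third of its length.  The resulting map is a quasi-isometry, and it
  fixes the boundary because it moves points along geodesics away from \<open>w\<close>.\<close>

lemma long_tubes_imp_not_boundary_rigid:
  assumes long: "\<And>n. real n \<le> b n - a n"
  shows "\<not> boundary_rigid TYPE('a)"
proof
  assume rigid: "boundary_rigid TYPE('a)"
  define \<phi> where "\<phi> = (\<lambda>n t. min (2 * t - a n) ((t + b n) / 2))"
  \<comment> \<open>As the minimum of two increasing maps, \<open>\<phi> n\<close> is inverted by the maximum of their inverses.\<close>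
  define \<psi> where "\<psi> = (\<lambda>n s. max ((s + a n) / 2) (2 * s - b n))"
  have \<phi>: "reparametrisation \<phi>" and \<psi>: "reparametrisation \<psi>"
    using tube_bounds(2) unfolding reparametrisation_def \<phi>_def \<psi>_def
    by (auto simp: min_def max_def field_simps abs_if) (metis order_antisym)+
  have \<psi>\<phi>: "\<psi> n (\<phi> n s) = s" "\<phi> n (\<psi> n s) = s" for n s
    by (auto simp: \<phi>_def \<psi>_def min_def max_def field_simps)
  define f where "f = shift \<phi>"
  have qi: "quasi_isometry f"
    unfolding f_def
    by (rule quasi_isometryI[OF shift_local[OF \<phi>] shift_local[OF \<psi>]
          shift_inverse[OF \<phi>] shift_inverse[OF \<psi>]]) (use \<psi>\<phi> constants in auto)
  have id: "\<forall>\<xi>\<in>gromov_boundary. boundary_map f \<xi> = \<xi>"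
  proof (intro ballI boundary_map_idI)
    have along: "dist w x - D \<le> gp w x (f x)" for x
    proof (cases "\<exists>n. in_tube n x")
      case True
      then obtain n where n: "in_tube n x" ..
      let ?s = "dist w x"
      have s: "?s \<in> {a n..b n}" using n by (simp add: in_tube_def)
      have fs: "f x = \<sigma> n (\<phi> n ?s)" "dist w (f x) = \<phi> n ?s"
        using shift_in_tube[OF n] shift_stays(2)[OF \<phi> n] by (auto simp: f_def)
      have up: "?s \<le> \<phi> n ?s" "\<phi> n ?s \<le> b n"
        using s by (auto simp: \<phi>_def min_def)
      then have "dist (\<sigma> n ?s) (f x) = \<phi> n ?s - ?s"
        using tube_dist[of ?s n "\<phi> n ?s"] s fs(1) by simp
      then have "dist x (f x) \<le> D + (\<phi> n ?s - ?s)"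
        using n dist_triangle[of x "f x" "\<sigma> n ?s"] by (simp add: in_tube_def)
      then show ?thesis using fs(2) up constants
        by (simp add: gromov_product_def dist_commute field_simps)
    next
      case False
      then show ?thesis using shift_outside[of x \<phi>] constants by (simp add: f_def)
    qed
    fix u :: "nat \<Rightarrow> 'a"
    assume u: "gromov_sequence u"
    have "gromov_sequence (f \<circ> u)"
      unfolding gromov_sequence_iff[of _ w]
    proof
      fix M
      obtain N where N: "\<And>i j. N \<le> i \<Longrightarrow> N \<le> j \<Longrightarrow> M + D + 2 * \<delta> \<le> gp w (u i) (u j)"
        using gromov_sequenceD[OF u] by blast
      have "M \<le> gp w ((f \<circ> u) i) ((f \<circ> u) j)" if "N \<le> i" "N \<le> j" for i j
        using six_point[of w "f (u i)" "u i" "u j" "f (u j)"] along[of "u i"] along[of "u j"]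
          N[of i i] N[of i j] N[of j j] that constants gp_commute[of w "u i" "f (u i)"] by simp
      then show "\<exists>N. \<forall>i\<ge>N. \<forall>j\<ge>N. M \<le> gp w ((f \<circ> u) i) ((f \<circ> u) j)" by blast
    qed
    moreover have "\<forall>\<^sub>F n in sequentially. M \<le> gp w (u n) ((f \<circ> u) n)" for M
      using gromov_sequence_eventually_far[OF u, of "M + D" w]
    proof eventually_elim
      case (elim n)
      then show ?case using along[of "u n"] by simp
    qed
    ultimately show "(u, f \<circ> u) \<in> gromov_rel" using u unfolding gromov_rel_iff[of _ _ w] by blast
  qed
  have "bdd_above (range (\<lambda>x. dist x (f x)))"
    by (rule mp[OF spec[OF rigid[unfolded boundary_rigid_def]] conjI[OF qi id]])
  then obtain M where M: "\<And>x. dist x (f x) \<le> M" by (auto simp: bdd_above_def)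
  obtain n :: nat where n: "3 * M < real n" using reals_Archimedean2 by blast
  define s where "s = (2 * a n + b n) / 3"
  have s: "s \<in> {a n..b n}" "(a n + 2 * b n) / 3 \<in> {a n..b n}"
    using tube_bounds(2)[of n] by (auto simp: s_def)
  have "\<phi> n s = (a n + 2 * b n) / 3" by (simp add: \<phi>_def s_def min_def field_simps)
  then have "f (\<sigma> n s) = \<sigma> n ((a n + 2 * b n) / 3)"
    by (simp only: f_def shift_in_tube[OF in_tube_centre[OF s(1)]] tube_height[OF s(1)])
  then have "dist (\<sigma> n s) (f (\<sigma> n s)) = (b n - a n) / 3"
    using tube_dist[OF s] tube_bounds(2)[of n] by (simp add: s_def field_simps)
  then show False using M[of "\<sigma> n s"] long[of n] n by simp
qed

end

context hyperbolic_geodesic begin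

lemma boundary_rigid_imp_branching:
  fixes w :: 'a
  assumes "visible_from w L" "boundary_rigid TYPE('a)"
  shows "\<exists>A. branching w A"
proof (rule ccontr)
  assume nb: "\<not> (\<exists>A. branching w A)"
  obtain D c a b \<sigma> where "0 \<le> D" "0 \<le> c" "\<And>n::nat. tube w D c (a n) (b n) (\<sigma> n)"
    and long: "\<And>n. real n \<le> b n - a n" and "\<And>n. b n + 2 \<le> a (Suc n)"
    using not_branching_imp_disjoint_tubes[OF assms(1) nb] by blast
  then interpret disjoint_tubes X \<delta> w D c a b \<sigma> by unfold_locales
  show False using long_tubes_imp_not_boundary_rigid[OF long] assms(2) by simp
qed

end

section \<open>Geodesic richness from centres\<close>

text \<open>Arzela-Ascoli in the form of the Tychonoff theorem: extending each segment by constants, all of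
  them lie in one compact product, and a cluster point is a line.\<close>

lemma line_of_long_segments:
  fixes S :: "'a::metric_space set"
  assumes proper: "proper_space TYPE('a)" and S: "closed S"
    and seg: "\<And>k::nat. \<exists>h. isometric_on {- real k..real k} h \<and> dist p (h 0) \<le> r \<and>
                h ` {- real k..real k} \<subseteq> S"
  obtains g :: "real \<Rightarrow> 'a" where "isometric_on UNIV g" "dist p (g 0) \<le> r" "range g \<subseteq> S"
proof -
  obtain h0 where h0: "\<And>k::nat. isometric_on {- real k..real k} (h0 k)"
      "\<And>k. dist p (h0 k 0) \<le> r" "\<And>k. h0 k ` {- real k..real k} \<subseteq> S"
    using seg by metis
  define h where "h = (\<lambda>k s. h0 k (max (- real k) (min (real k) s)))"
  define K where "K = PiE UNIV (\<lambda>s. cball p (r + \<bar>s\<bar>))"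
  have "compactin (product_topology (\<lambda>s. euclidean) UNIV) K"
    unfolding K_def compactin_PiE using proper by (simp add: proper_space_def)
  then have K: "compact K" by (simp add: euclidean_product_topology)
  have hK: "h k \<in> K" for k
  proof -
    have "dist p (h k s) \<le> r + \<bar>s\<bar>" for s
    proof -
      have "dist (h0 k 0) (h k s) = \<bar>0 - max (- real k) (min (real k) s)\<bar>"
        unfolding h_def by (rule isometric_on_dist[OF h0(1)]) auto
      also have "\<dots> \<le> \<bar>s\<bar>" by auto
      finally show ?thesis using h0(2)[of k] dist_triangle[of p "h k s" "h0 k 0"] by linarith
    qed
    then show ?thesis by (simp add: K_def PiE_UNIV_domain)
  qed
  define F where "F = filtermap h sequentially"
  have "F \<noteq> bot" "eventually (\<lambda>x. x \<in> K) F"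
    using hK by (simp_all add: F_def filtermap_bot_iff eventually_filtermap)
  then obtain g where g: "inf (nhds g) F \<noteq> bot" using K unfolding compact_filter by blast
  let ?G = "inf (nhds g) F"
  have lim: "((\<lambda>x. x s) \<longlongrightarrow> g s) ?G" for s
  proof -
    have "((\<lambda>x::real \<Rightarrow> 'a. x s) \<longlongrightarrow> g s) (nhds g)"
      unfolding tendsto_def eventually_nhds
    proof (intro allI impI)
      fix U :: "'a set"
      assume U: "open U" "g s \<in> U"
      have "open ((\<lambda>x::real \<Rightarrow> 'a. x s) -` U)"
        by (rule open_vimage[OF U(1) continuous_on_product_coordinates])
      then show "\<exists>V. open V \<and> g \<in> V \<and> (\<forall>x\<in>V. x s \<in> U)" using U(2) by blast
    qed
    then show ?thesis by (rule tendsto_mono[rotated]) simp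
  qed
  have ev: "eventually P ?G" if "\<forall>\<^sub>F k in sequentially. P (h k)" for P
  proof -
    have "eventually P F" using that by (simp add: F_def eventually_filtermap)
    then show ?thesis by (rule filter_leD[rotated]) simp
  qed
  show thesis
  proof (rule that)
    show "isometric_on UNIV g"
      unfolding isometric_on_def
    proof (intro ballI)
      fix s t
      obtain N :: nat where N: "max \<bar>s\<bar> \<bar>t\<bar> \<le> real N" using real_arch_simple by blast
      have "dist (h k s) (h k t) = dist s t" if "N \<le> k" for k
      proof -
        have "\<bar>s\<bar> \<le> real k" "\<bar>t\<bar> \<le> real k" using N that by linarith+
        then have "h k s = h0 k s" "h k t = h0 k t" "s \<in> {- real k..real k}" "t \<in> {- real k..real k}"
          by (auto simp: h_def abs_le_iff min_def max_def)
        then show ?thesis using h0(1)[of k] by (simp add: isometric_on_def)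
      qed
      then have "\<forall>\<^sub>F x in ?G. dist (x s) (x t) \<in> {dist s t}"
        by (intro ev) (auto simp: eventually_sequentially)
      then have "dist (g s) (g t) \<in> {dist s t}"
        by (intro Lim_in_closed_set[OF _ _ g tendsto_dist[OF lim lim]]) auto
      then show "dist (g s) (g t) = dist s t" by simp
    qed
    have "g 0 \<in> cball p r"
      using h0(2) by (intro Lim_in_closed_set[OF _ _ g lim] ev) (auto simp: h_def)
    then show "dist p (g 0) \<le> r" by simp
    show "range g \<subseteq> S"
    proof
      fix x
      assume "x \<in> range g"
      then obtain s where s: "x = g s" by blast
      have "max (- real k) (min (real k) s) \<in> {- real k..real k}" for k by auto
      then have "h k s \<in> S" for k using h0(3)[of k] unfolding h_def by blast
      then show "x \<in> S" unfolding s by (intro Lim_in_closed_set[OF S _ g lim] ev) auto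
    qed
  qed
qed

context hyperbolic_geodesic begin

text \<open>The geodesic from \<open>a\<close> to \<open>b\<close> passes near \<open>p\<close>.  Seen from there, a point \<open>x\<close> of it lies on the way
  to one of the ends, and if \<open>x\<close> were in the direction of \<open>q\<close>, so would be that end.\<close>

lemma segment_away_from_point:
  fixes p q :: 'a
  assumes ab: "gp p a b \<le> C" and away: "gp p q a \<le> C + \<delta>" "gp p q b \<le> C + \<delta>"
    and far: "k + (C + 2 * \<delta>) \<le> dist p a" "k + (C + 2 * \<delta>) \<le> dist p b"
  shows "\<exists>h. isometric_on {-k..k} h \<and> dist p (h 0) \<le> C + 2 * \<delta> \<and>
    h ` {-k..k} \<subseteq> {x. gp p q x \<le> 3 * C + 6 * \<delta>}"
proof -
  obtain g where g: "geodesic_path g a b" using geodesic_between .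
  define t m where "t = gp a p b" and "m = g t"
  have t: "0 \<le> t" "t \<le> dist a b" by (simp_all add: t_def gp_nonneg gp_le_dist)
  have pm: "dist p m \<le> C + 2 * \<delta>" using dist_tangent_point[OF g, of p] ab by (simp add: m_def t_def)
  have m: "dist a m = t" "dist m b = dist a b - t"
    using geodesic_path_dist_ends[OF g t] by (auto simp: m_def)
  have k: "k \<le> t" "k \<le> dist a b - t"
    using far pm m dist_triangle[of p a m] dist_triangle[of p b m] by (auto simp: dist_commute)
  define h where "h = (\<lambda>s. g (t + s))"
  have "isometric_on {-k..k} h"
    using geodesic_path_dist[OF g] k unfolding isometric_on_def h_def
    by (auto simp: dist_real_def)
  moreover have "gp p q (h s) \<le> 3 * C + 6 * \<delta>" if s: "s \<in> {-k..k}" for s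
  proof -
    have ts: "0 \<le> t + s" "t + s \<le> dist a b" using s k by auto
    define x where "x = h s"
    have x: "dist a x = t + s" "dist x b = dist a b - (t + s)"
      using geodesic_path_dist_ends[OF g ts] by (auto simp: x_def h_def)
    have mx: "dist m x = \<bar>s\<bar>"
      using geodesic_path_dist[OF g t ts] by (simp add: m_def x_def h_def)
    have "\<exists>e. gp p q e \<le> C + \<delta> \<and> gp m x e = dist m x"
    proof (cases "0 \<le> s")
      case True
      then have "gp m x b = dist m x" using x m mx by (simp add: gromov_product_def dist_commute)
      then show ?thesis using away by blast
    next
      case False
      then have "gp m x a = dist m x" using x m mx by (simp add: gromov_product_def dist_commute)
      then show ?thesis using away by blast
    qed
    then obtain e where e: "gp p q e \<le> C + \<delta>" "gp m x e = dist m x" by blast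
    have "dist p x - 2 * dist p m \<le> gp p x e"
      using e(2) gp_change_base[of m x e p] dist_triangle[of p x m] by (simp add: dist_commute)
    then show ?thesis
      using four_point[of p q x e] e(1) gp_le_dist(2)[of p q x] pm delta_nonneg zero_le_dist[of p m]
      unfolding x_def[symmetric] by (smt (verit))
  qed
  ultimately show ?thesis using pm by (intro exI[of _ h]) (auto simp: h_def m_def)
qed

lemma line_away_from_point:
  fixes p q :: 'a
  assumes proper: "proper_space TYPE('a)" and ctr: "coarse_centre C p"
  obtains g :: "real \<Rightarrow> 'a" where "isometric_on UNIV g" "dist p (g 0) \<le> C + 2 * \<delta>"
    "range g \<subseteq> {x. gp p q x \<le> 3 * C + 6 * \<delta>}"
proof -
  let ?S = "{x. gp p q x \<le> 3 * C + 6 * \<delta>}"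
  obtain u v z where gs: "gromov_sequence u" "gromov_sequence v" "gromov_sequence z"
    and uvz: "\<forall>\<^sub>F n in sequentially. gp p (u n) (v n) \<le> C \<and> gp p (v n) (z n) \<le> C \<and> gp p (u n) (z n) \<le> C"
    using ctr unfolding coarse_centre_def by blast
  have closed: "closed ?S"
    unfolding gromov_product_def by (intro closed_Collect_le continuous_intros) auto
  have seg: "\<exists>h. isometric_on {- real k..real k} h \<and> dist p (h 0) \<le> C + 2 * \<delta> \<and>
      h ` {- real k..real k} \<subseteq> ?S" for k
  proof -
    let ?M = "real k + (C + 2 * \<delta>)"
    have ev: "\<forall>\<^sub>F n in sequentially. \<exists>a b. gp p a b \<le> C \<and> gp p q a \<le> C + \<delta> \<and> gp p q b \<le> C + \<delta> \<and>
        ?M \<le> dist p a \<and> ?M \<le> dist p b"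
      using uvz gs[THEN gromov_sequence_eventually_far, of ?M p]
    proof eventually_elim
      case (elim n)
      then show ?case using two_of_three_away[of p "u n" "v n" C "z n" q] by blast
    qed
    obtain a b where "gp p a b \<le> C" "gp p q a \<le> C + \<delta>" "gp p q b \<le> C + \<delta>"
        "?M \<le> dist p a" "?M \<le> dist p b"
      using eventually_happens'[OF sequentially_bot ev] by blast
    then show ?thesis by (rule segment_away_from_point)
  qed
  show thesis by (rule line_of_long_segments[OF proper closed seg that])
qed

lemma infdist_line_le:
  fixes g :: "real \<Rightarrow> 'a"
  assumes g: "isometric_on UNIV g"
  shows "infdist q (range g) \<le> gp q (g s) (g t) + 2 * \<delta>"
proof -
  have ordered: "infdist q (range g) \<le> gp q (g s) (g t) + 2 * \<delta>" if "s \<le> t" for s t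
  proof -
    define h where "h = (\<lambda>\<tau>. g (s + \<tau>))"
    have "geodesic_path h (g s) (g t)"
      using that unfolding geodesic_path_def isometric_on_def h_def
      by (auto simp: isometric_on_dist[OF g] dist_real_def)
    then have "dist q (h (gp (g s) q (g t))) \<le> gp q (g s) (g t) + 2 * \<delta>"
      by (rule dist_tangent_point)
    then show ?thesis by (intro infdist_le2) (auto simp: h_def)
  qed
  show ?thesis using ordered[of s t] ordered[of t s] by (cases "s \<le> t") (auto simp: gp_commute)
qed

text \<open>Unless \<open>p\<close> and \<open>q\<close> are close, a geodesic from \<open>x\<close> to \<open>y\<close> has to pass by both of them.\<close>

lemma dist_away_from_both:
  fixes p q x y :: 'a
  assumes x: "gp p q x \<le> c1" and y: "gp q p y \<le> c2"
  shows "dist p q - 2 * c1 - 2 * c2 - 2 * \<delta> \<le> dist x y"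
proof -
  have c: "0 \<le> c1" "0 \<le> c2" using x y gp_nonneg order_trans by blast+
  have yq: "dist p q - c2 \<le> gp p q y" using y gp_swap[of p q y] by linarith
  have "dist x y = dist p x + dist p y - 2 * gp p x y"
    by (simp add: gromov_product_def dist_commute field_simps)
  moreover have "gp p q y \<le> dist p y" "gp p x y \<le> dist p x" by (rule gp_le_dist)+
  ultimately show ?thesis
    using four_point[of p q y x] x yq c delta_nonneg zero_le_dist[of x y] gp_commute[of p x y]
      gp_nonneg[of p q y] by (smt (verit))
qed

text \<open>Both conditions hold for the line near \<open>p\<close> that leads away from \<open>q\<close>.  For the second one
  \<open>q\<close> is an almost nearest point to \<open>p\<close> on the given line \<open>G\<close>: then no point of \<open>G\<close> lies towards \<open>p\<close> as
  seen from \<open>q\<close>.\<close>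

lemma coarse_centres_imp_geodesically_rich:
  assumes proper: "proper_space TYPE('a)" and ctr: "\<And>x::'a. coarse_centre C x"
  shows "geodesically_rich TYPE('a)"
proof -
  define c0 c1 where "c0 = C + 2 * \<delta>" and "c1 = 3 * C + 6 * \<delta>"
  have line: "\<exists>g::real \<Rightarrow> 'a. isometric_on UNIV g \<and> dist p (g 0) \<le> c0 \<and> range g \<subseteq> {x. gp p q x \<le> c1}"
    for p q :: 'a
  proof -
    obtain g :: "real \<Rightarrow> 'a" where "isometric_on UNIV g" "dist p (g 0) \<le> C + 2 * \<delta>"
        "range g \<subseteq> {x. gp p q x \<le> 3 * C + 6 * \<delta>}"
      by (rule line_away_from_point[OF proper ctr[of p], of q])
    then show ?thesis unfolding c0_def c1_def by blast
  qed
  have first: "\<exists>G. bi_infinite_geodesic G \<and> infdist p G < c0 + 1 \<and>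
      \<bar>infdist q G - dist p q\<bar> < \<bar>c0\<bar> + \<bar>2 * c1\<bar> + 1" for p q :: 'a
  proof -
    obtain g :: "real \<Rightarrow> 'a" where g: "isometric_on UNIV g" "dist p (g 0) \<le> c0" "range g \<subseteq> {x. gp p q x \<le> c1}"
      using line[of p q] by blast
    have "dist p q - 2 * c1 \<le> (INF x\<in>range g. dist q x)"
    proof (rule cINF_greatest)
      fix x
      assume "x \<in> range g"
      then have "gp p q x \<le> c1" using g(3) by blast
      moreover have "dist q x = dist p q + dist p x - 2 * gp p q x"
        by (simp add: gromov_product_def dist_commute field_simps)
      ultimately show "dist p q - 2 * c1 \<le> dist q x" using zero_le_dist[of p x] by linarith
    qed simp
    then have "dist p q - 2 * c1 \<le> infdist q (range g)" by (simp add: infdist_notempty)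
    moreover have "infdist p (range g) \<le> c0" using g(2) by (intro infdist_le2) auto
    moreover have "infdist q (range g) \<le> dist q (g 0)" by (rule infdist_le) simp
    moreover have "dist q (g 0) \<le> dist p q + c0"
      using g(2) dist_triangle[of q "g 0" p] by (simp add: dist_commute)
    ultimately have "infdist p (range g) < c0 + 1"
        "\<bar>infdist q (range g) - dist p q\<bar> < \<bar>c0\<bar> + \<bar>2 * c1\<bar> + 1"
      by linarith+
    then show ?thesis using g(1) unfolding bi_infinite_geodesic_def by blast
  qed
  have second: "\<exists>G'. bi_infinite_geodesic G' \<and> infdist p G' < c0 + 1 \<and>
      \<bar>infdist p G - setdist G' G\<bar> < \<bar>c0\<bar> + \<bar>2 * c1\<bar> + 6 * \<delta> + 4"
    if G: "bi_infinite_geodesic G" for G and p :: 'a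
  proof -
    obtain \<gamma> :: "real \<Rightarrow> 'a" where \<gamma>: "isometric_on UNIV \<gamma>" "G = range \<gamma>" using G unfolding bi_infinite_geodesic_def by blast
    have "infdist p G < infdist p G + 1" "G \<noteq> {}" using \<gamma> by auto
    then obtain q where q: "q \<in> G" "dist p q < infdist p G + 1" using infdist_less_witness by blast
    have away: "gp q p y \<le> 1 + 2 * \<delta>" if y: "y \<in> G" for y
    proof -
      have "infdist p G \<le> gp p q y + 2 * \<delta>"
        using infdist_line_le[OF \<gamma>(1)] q(1) y unfolding \<gamma>(2) by blast
      then show ?thesis using q(2) gp_swap[of p q y] by linarith
    qed
    obtain g :: "real \<Rightarrow> 'a" where g: "isometric_on UNIV g" "dist p (g 0) \<le> c0" "range g \<subseteq> {x. gp p q x \<le> c1}"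
      using line[of p q] by blast
    have "infdist p (range g) \<le> c0" using g(2) by (intro infdist_le2) auto
    moreover have "setdist (range g) G \<le> dist (g 0) q" using q(1) by (intro setdist_le_dist) auto
    moreover have "dist p q - 2 * c1 - 2 * (1 + 2 * \<delta>) - 2 * \<delta> \<le> setdist (range g) G"
      using q(1) g(3) by (intro le_setdistI dist_away_from_both away) auto
    moreover have "infdist p G \<le> dist p q" using q(1) by (rule infdist_le)
    moreover have "dist (g 0) q \<le> c0 + dist p q"
      using g(2) dist_triangle[of "g 0" q p] by (simp add: dist_commute)
    ultimately have "infdist p (range g) < c0 + 1"
        "\<bar>infdist p G - setdist (range g) G\<bar> < \<bar>c0\<bar> + \<bar>2 * c1\<bar> + 6 * \<delta> + 4"
      using q(2) delta_nonneg by (auto simp: abs_less_iff distrib_left)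
    then show ?thesis using g(1) unfolding bi_infinite_geodesic_def by blast
  qed
  show ?thesis unfolding geodesically_rich_def using first second by blast
qed

section \<open>Branching from geodesic richness\<close>

text \<open>On the way to the boundary point of \<open>u\<close> take \<open>p\<close> at height \<open>t\<close> and \<open>q\<close> at height \<open>t + r\<close>.
  A line near \<open>p\<close> and far from \<open>q\<close> has an end that leads away from \<open>w\<close> at \<open>p\<close>, and this end
  separates from \<open>u\<close> between \<open>p\<close> and \<open>q\<close>.\<close>

lemma geodesically_rich_imp_branching:
  fixes w :: 'a
  assumes rich: "geodesically_rich TYPE('a)"
  shows "\<exists>A. branching w A"
proof -
  obtain r0 r1 r2 where lines: "\<And>p q::'a. r0 \<le> dist p q \<Longrightarrow>
      \<exists>G. bi_infinite_geodesic G \<and> infdist p G < r1 \<and> \<bar>infdist q G - dist p q\<bar> < r2"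
    using rich unfolding geodesically_rich_def by metis
  define r where "r = max \<bar>r0\<bar> (r1 + r2 + 4 * \<delta>)"
  have r: "0 \<le> r" "r0 \<le> r" "r1 + r2 + 4 * \<delta> \<le> r" by (auto simp: r_def)
  have "branching w (r + \<bar>r1\<bar> + 2 * \<delta>)"
    unfolding branching_def
  proof (intro allI impI)
    fix u :: "nat \<Rightarrow> 'a" and t :: real
    assume u: "gromov_sequence u" and t: "0 \<le> t"
    obtain N where N: "\<And>i j. N \<le> i \<Longrightarrow> N \<le> j \<Longrightarrow> t + r \<le> gp w (u i) (u j)"
      using gromov_sequenceD[OF u] by blast
    have far: "t + r \<le> dist w (u N)" using N[of N N] by simp
    obtain \<sigma> where \<sigma>: "geodesic_path \<sigma> w (u N)" using geodesic_between .
    define p q where "p = \<sigma> t" and "q = \<sigma> (t + r)"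
    have pq: "dist p q = r" "dist w p = t" "dist w q = t + r"
      "dist p (u N) = dist w (u N) - t" "dist q (u N) = dist w (u N) - (t + r)"
      using geodesic_path_dist[OF \<sigma>, of t "t + r"] geodesic_path_dist_ends[OF \<sigma>, of t]
        geodesic_path_dist_ends[OF \<sigma>, of "t + r"] t r far by (auto simp: p_def q_def)
    have gpN: "gp w p (u N) = t" "gp w q (u N) = t + r" "gp w p q = t"
      using pq by (auto simp: gromov_product_def dist_commute)
    obtain g :: "real \<Rightarrow> 'a" where g: "isometric_on UNIV g" "infdist p (range g) < r1"
        "\<bar>infdist q (range g) - r\<bar> < r2"
      using lines[of p q] pq(1) r(2) unfolding bi_infinite_geodesic_def by auto
    obtain y where "y \<in> range g" "dist p y < r1"
      using infdist_less_witness[OF g(2)] by auto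
    then obtain s where s: "dist p (g s) < r1" by blast
    obtain \<tau> :: real where \<tau>: "\<tau> = 1 \<or> \<tau> = -1"
        "\<And>n::nat. \<bar>s\<bar> \<le> real n \<Longrightarrow> gp (g s) w (g (\<tau> * real n)) \<le> \<delta>"
      using line_end_away_from_point[OF g(1), of s w] by blast
    define v where "v = (\<lambda>n. g (\<tau> * real n))"
    have v: "gromov_sequence v"
      unfolding v_def by (rule line_end_gromov_sequence)
        (rule disjE[OF \<tau>(1)]; simp add: isometric_on_dist[OF g(1)])
    obtain N' :: nat where N': "\<bar>s\<bar> \<le> real N'" using real_arch_simple by blast
    have "\<bar>gp w (u n) (v n) - t\<bar> \<le> r + \<bar>r1\<bar> + 2 * \<delta>" if n: "max N N' \<le> n" for n
    proof -
      have nN: "N \<le> n" "\<bar>s\<bar> \<le> real n" using n N' by auto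
      have "gp (g s) w (v n) \<le> \<delta>" using \<tau>(2)[OF nN(2)] by (simp add: v_def)
      then have wv: "gp p w (v n) \<le> \<delta> + r1"
        using gp_change_base[of p w "v n" "g s"] s by linarith
      have pu: "t - \<delta> \<le> gp w p (u n)" "gp w p (u n) \<le> t"
        using four_point[of w p "u N" "u n"] gpN N[OF _ nN(1), of N] r(1) gp_le_dist(1)[of w p "u n"] pq
        by auto
      have qu: "r - \<delta> \<le> gp p q (u n)"
        using four_point[of w q "u N" "u n"] gpN N[OF _ nN(1), of N] pu(2) pq(2)
          gp_rebase[of p q "u n" w] by auto
      have uv: "gp p (u n) (v n) \<le> r"
      proof (rule ccontr)
        assume "\<not> ?thesis"
        then have "r - 2 * \<delta> \<le> gp p q (v n)"
          using four_point[of p q "u n" "v n"] qu delta_nonneg by linarith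
        then have "gp q p (v n) \<le> 2 * \<delta>" using gp_swap[of p q "v n"] pq(1) by linarith
        then have "gp q (g s) (v n) \<le> 2 * \<delta> + r1"
          using gp_change_arg[of q p "v n" "g s"] s by linarith
        then have "infdist q (range g) \<le> 4 * \<delta> + r1"
          using infdist_line_le[OF g(1), of q s "\<tau> * real n"] unfolding v_def by linarith
        then show False using g(3) r(3) by linarith
      qed
      have "gp w (u n) (v n) = gp p (u n) (v n) - gp p w (u n) - gp p w (v n) + t"
        using gp_rebase[of w "u n" "v n" p] pq(2) by (simp add: dist_commute)
      moreover have "gp p w (u n) \<le> \<delta>" using gp_swap[of w p "u n"] pu(1) pq(2) by linarith
      ultimately show ?thesis
        using uv wv r(1) delta_nonneg gp_nonneg[of p "u n" "v n"] gp_nonneg[of p w "u n"]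
          gp_nonneg[of p w "v n"] by linarith
    qed
    then have "\<forall>\<^sub>F n in sequentially. \<bar>gp w (u n) (v n) - t\<bar> \<le> r + \<bar>r1\<bar> + 2 * \<delta>"
      unfolding eventually_sequentially by blast
    then show "\<exists>v. gromov_sequence v \<and>
        (\<forall>\<^sub>F n in sequentially. \<bar>gp w (u n) (v n) - t\<bar> \<le> r + \<bar>r1\<bar> + 2 * \<delta>)"
      using v by blast
  qed
  then show ?thesis by blast
qed

end

section \<open>The equivalence\<close>

theorem theorem1p11:
  fixes \<rho> :: "(nat \<Rightarrow> 'a::metric_space) set \<Rightarrow> (nat \<Rightarrow> 'a) set \<Rightarrow> real"
  assumes "proper_space TYPE('a)"
    and "geodesic_space TYPE('a)"
    and "gromov_hyperbolic TYPE('a)"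
    and "has_pole TYPE('a)"
    and "visual_metric \<rho>"
  shows "(boundary_rigid TYPE('a) \<longleftrightarrow> uniformly_perfect (gromov_boundary :: (nat \<Rightarrow> 'a) set set) \<rho>) \<and>
         (uniformly_perfect (gromov_boundary :: (nat \<Rightarrow> 'a) set set) \<rho> \<longleftrightarrow> geodesically_rich TYPE('a))"
proof -
  obtain w :: 'a and \<delta> \<epsilon> where \<delta>: "0 < \<delta>" "delta_thin TYPE('a) \<delta>"
    and \<epsilon>: "0 < \<epsilon>" "\<epsilon> < min 1 (1 / (5 * \<delta>))" and \<rho>: "\<rho> = visual_dist w \<epsilon>"
    using assms(5) unfolding visual_metric_def by blast
  interpret hyperbolic_geodesic "TYPE('a)" \<delta>
    by (rule delta_thin_imp_hyperbolic_geodesic[OF assms(2) \<delta>(2)])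
  have \<epsilon>\<delta>: "\<epsilon> * \<delta> < 1 / 5" using \<epsilon> \<delta>(1) by (simp add: field_simps)
  obtain L where vis: "visible_from w L" using has_pole_imp_visible_from[OF assms(4)] by blast
  have up: "uniformly_perfect gromov_boundary \<rho> \<longleftrightarrow> (\<exists>A. branching w A)"
    unfolding \<rho> using uniformly_perfect_imp_branching[OF \<epsilon>(1) \<epsilon>\<delta>]
      branching_imp_uniformly_perfect[OF \<epsilon>(1) \<epsilon>\<delta>] by blast
  have centres: "\<exists>C. \<forall>x::'a. coarse_centre C x" if "\<exists>A. branching w A"
    using that branching_imp_coarse_centre[OF _ vis] by blast
  have "boundary_rigid TYPE('a) \<longleftrightarrow> (\<exists>A. branching w A)"
    using boundary_rigid_imp_branching[OF vis] centres coarse_centres_imp_boundary_rigid by blast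
  moreover have "geodesically_rich TYPE('a) \<longleftrightarrow> (\<exists>A. branching w A)"
    using geodesically_rich_imp_branching centres
      coarse_centres_imp_geodesically_rich[OF assms(1)] by blast
  ultimately show ?thesis using up by blast
qed

end
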